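(* Let $(\mathfrak g,\cdot_{\mathfrak g})$ be a mock-pre-Lie algebra and $r\in\mathfrak g\otimes\mathfrak g$. Then the map $\alpha:\mathfrak g\to\mathfrak g\otimes\mathfrak g$ defined by $\alpha(x)=(\mathrm{Id}\otimes R_x+\mathrm{Id}\otimes L_x-L_x\otimes\mathrm{Id})r$ induces a mock-pre-Lie algebra structure on $\mathfrak g^*$ such that $(\mathfrak g,\mathfrak g^* )$ is a mock-pre-Lie bialgebra if and only if the following two conditions are satisfied: (i) $[P_-(x\cdot_{\mathfrak g}y)+P_+(x)P_-(y)](r-\tau(r))=0$ for all $x,y\in\mathfrak g$; (ii) $Q(x)[[r,r]]=0$ for all $x\in\mathfrak g$.
   Context: All vector spaces are finite-dimensional over an algebraically closed field $\mathbb K$ of characteristic $0$. A mock-pre-Lie algebra is a vector space with a bilinear product satisfying $(x\cdot y)\cdot z+x\cdot(y\cdot z)=-(y\cdot x)\cdot z-y\cdot(x\cdot z)$. Write $\{x,y\}=x\cdot_{\mathfrak g}y+y\cdot_{\mathfrak g}x$, $L_xy=x\cdot_{\mathfrak g}y$, $R_xy=y\cdot_{\mathfrak g}x$. On $\mathfrak g^*$ the product induced by $\alpha$ is $\alpha^*$: $\langle\xi\cdot_{\mathfrak g^*}\eta,x\rangle=\langle\xi\otimes\eta,\alpha(x)\rangle$; write $\mathcal L_\xi\eta=\xi\cdot_{\mathfrak g^*}\eta$, $\mathcal R_\xi\eta=\eta\cdot_{\mathfrak g^*}\xi$, $\{\xi,\eta\}_{\mathfrak g^*}=\xi\cdot_{\mathfrak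 g^*}\eta+\eta\cdot_{\mathfrak g^*}\xi$. Let $\beta:\mathfrak g^*\to\mathfrak g^*\otimes\mathfrak g^*$ be the dual of the product of $\mathfrak g$: $\langle\beta(\xi),x\otimes y\rangle=\langle\xi,x\cdot_{\mathfrak g}y\rangle$. $(\mathfrak g,\mathfrak g^* )=(\mathfrak g,\mathfrak g^*,\alpha,\beta)$ is a mock-pre-Lie bialgebra if $\alpha^*$ and $\beta^*$ are mock-pre-Lie products on $\mathfrak g^*$ and $\mathfrak g$ and $$\alpha\{x,y\}=-(\mathrm{Id}\otimes(R_y+L_y)+L_y\otimes\mathrm{Id})\alpha(x)-(\mathrm{Id}\otimes(L_x+R_x)+L_x\otimes\mathrm{Id})\alpha(y),$$ $$\beta\{\xi,\eta\}_{\mathfrak g^*}=-(\mathrm{Id}\otimes(\mathcal R_\eta+\mathcal L_\eta)+\mathcal L_\eta\otimes\mathrm{Id})\beta(\xi)-(\mathrm{Id}\otimes(\mathcal L_\xi+\mathcal R_\xi)+\mathcal L_\xi\otimes\mathrm{Id})\beta(\eta)$$ for all $x,y\in\mathfrak g$, $\xi,\eta\in\mathfrak g^*$. Operators: $\tau(x\otimes y)=y\otimes x$; $P_\pm(x)=L_x\otimes\mathrm{Id}\pm\mathrm{Id}\otimes L_x$ on $\mathfrak g\otimes\mathfrak g$; $Q(x)=L_x\otimes\mathrm{Id}\otimes\mathrm{Id}+\mathrm{Id}\otimes L_x\otimes\mathrm{Id}+\mathrm{Id}\otimes\mathrm{Id}\otimes R_x+\mathrm{Id}\otimes\mathrm{Id}\otimes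 L_x$ on $\mathfrak g^{\otimes3}$. For $r=\sum_ia_i\otimes b_i$, $[[r,r]]=-r_{13}\cdot r_{12}-r_{23}\cdot r_{21}+\{r_{23},r_{12}\}+\{r_{13},r_{21}\}-\{r_{13},r_{23}\}\in\mathfrak g^{\otimes3}$, where $r_{12}=\sum a_i\otimes b_i\otimes1$, $r_{21}=\sum b_i\otimes a_i\otimes1$, $r_{13}=\sum a_i\otimes1\otimes b_i$, $r_{23}=\sum1\otimes a_i\otimes b_i$ ($1$ a formal unit) and products/brackets are taken in the common slot; explicitly $$[[r,r]]=\sum_{i,j}\big(-a_i\cdot_{\mathfrak g}a_j\otimes b_j\otimes b_i-b_j\otimes a_i\cdot_{\mathfrak g}a_j\otimes b_i+a_j\otimes\{a_i,b_j\}\otimes b_i+\{a_i,b_j\}\otimes a_j\otimes b_i-a_i\otimes a_j\otimes\{b_i,b_j\}\big).$$ *)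

theory Defs
  imports "HOL-Computational_Algebra.Polynomial" "HOL-Library.Function_Algebras"
begin

section \<open>Linear algebra over a carrier\<close>

text \<open>
  A vector space is given by a scalar multiplication together with a carrier. The algebra
  \<open>g\<close> is a whole type, with carrier \<^const>\<open>UNIV\<close>; its dual is a subspace of the space of all
  functions from that type to the field.
\<close>

definition linear_on ::
  "('k::field \<Rightarrow> 'v::ab_group_add \<Rightarrow> 'v) \<Rightarrow> ('k \<Rightarrow> 'w::ab_group_add \<Rightarrow> 'w) \<Rightarrow> 'v set \<Rightarrow> ('v \<Rightarrow> 'w) \<Rightarrow> bool"
  where "linear_on s s' V f \<longleftrightarrow>
    (\<forall>u\<in>V. \<forall>v\<in>V. f (u + v) = f u + f v) \<and> (\<forall>c. \<forall>v\<in>V. f (s c v) = s' c (f v))"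

definition bilinear_on ::
  "('k::field \<Rightarrow> 'v::ab_group_add \<Rightarrow> 'v) \<Rightarrow> ('k \<Rightarrow> 'w::ab_group_add \<Rightarrow> 'w) \<Rightarrow> 'v set \<Rightarrow> ('v \<Rightarrow> 'v \<Rightarrow> 'w) \<Rightarrow> bool"
  where "bilinear_on s s' V f \<longleftrightarrow>
    (\<forall>v\<in>V. linear_on s s' V (\<lambda>u. f u v)) \<and> (\<forall>u\<in>V. linear_on s s' V (\<lambda>v. f u v))"

definition trilinear_on ::
  "('k::field \<Rightarrow> 'v::ab_group_add \<Rightarrow> 'v) \<Rightarrow> ('k \<Rightarrow> 'w::ab_group_add \<Rightarrow> 'w) \<Rightarrow> 'v set \<Rightarrow> ('v \<Rightarrow> 'v \<Rightarrow> 'v \<Rightarrow> 'w) \<Rightarrow> bool"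
  where "trilinear_on s s' V f \<longleftrightarrow>
    (\<forall>v\<in>V. \<forall>w\<in>V. linear_on s s' V (\<lambda>u. f u v w)) \<and>
    (\<forall>u\<in>V. \<forall>w\<in>V. linear_on s s' V (\<lambda>v. f u v w)) \<and>
    (\<forall>u\<in>V. \<forall>v\<in>V. linear_on s s' V (\<lambda>w. f u v w))"

definition fscale :: "'k::field \<Rightarrow> ('b \<Rightarrow> 'k) \<Rightarrow> 'b \<Rightarrow> 'k"
  where "fscale c f = (\<lambda>x. c * f x)"

definition dual :: "('k::field \<Rightarrow> 'v::ab_group_add \<Rightarrow> 'v) \<Rightarrow> ('v \<Rightarrow> 'k) set"
  where "dual s = {\<xi>. Vector_Spaces.linear s (*) \<xi>}"


section \<open>Tensor squares and cubes\<close>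

text \<open>
  The tensor \<open>u \<otimes> v\<close> is realized as evaluation at \<open>(u, v)\<close> on the bilinear forms of the space,
  and \<open>V \<otimes> V\<close> as the linear span of these evaluations; likewise for \<open>V \<otimes> V \<otimes> V\<close> and
  trilinear forms. The universal property is \<open>tensor_square_universal\<close> below. Forms are only
  constrained on the carrier; off the set of bilinear forms a tensor has the value 0, so that
  equality of tensors is equality of functions.
\<close>

type_synonym ('v, 'k) tensor2 = "('v \<Rightarrow> 'v \<Rightarrow> 'k) \<Rightarrow> 'k"
type_synonym ('v, 'k) tensor3 = "('v \<Rightarrow> 'v \<Rightarrow> 'v \<Rightarrow> 'k) \<Rightarrow> 'k"

definition tens2 ::
  "('k::field \<Rightarrow> 'v::ab_group_add \<Rightarrow> 'v) \<Rightarrow> 'v set \<Rightarrow> 'v \<Rightarrow> 'v \<Rightarrow> ('v, 'k) tensor2"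
  where "tens2 s V u v = (\<lambda>f. if bilinear_on s (*) V f then f u v else 0)"

definition tens3 ::
  "('k::field \<Rightarrow> 'v::ab_group_add \<Rightarrow> 'v) \<Rightarrow> 'v set \<Rightarrow> 'v \<Rightarrow> 'v \<Rightarrow> 'v \<Rightarrow> ('v, 'k) tensor3"
  where "tens3 s V u v w = (\<lambda>f. if trilinear_on s (*) V f then f u v w else 0)"

definition tensor_square ::
  "('k::field \<Rightarrow> 'v::ab_group_add \<Rightarrow> 'v) \<Rightarrow> 'v set \<Rightarrow> ('v, 'k) tensor2 set"
  where "tensor_square s V = module.span fscale {tens2 s V u v | u v. u \<in> V \<and> v \<in> V}"

text \<open>
  \<open>tmap2 s V A B\<close> is \<open>A \<otimes> B\<close> and \<open>tmap3 s V A B C\<close> is \<open>A \<otimes> B \<otimes> C\<close>, for linear operators on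
  \<open>V\<close>; \<open>tflip\<close> is the exchange \<open>\<tau>\<close>.
\<close>

definition tmap2 ::
  "('k::field \<Rightarrow> 'v::ab_group_add \<Rightarrow> 'v) \<Rightarrow> 'v set \<Rightarrow> ('v \<Rightarrow> 'v) \<Rightarrow> ('v \<Rightarrow> 'v) \<Rightarrow>
    ('v, 'k) tensor2 \<Rightarrow> ('v, 'k) tensor2"
  where "tmap2 s V A B t =
    (\<lambda>f. if bilinear_on s (*) V f then t (\<lambda>u v. f (A u) (B v)) else 0)"

definition tmap3 ::
  "('k::field \<Rightarrow> 'v::ab_group_add \<Rightarrow> 'v) \<Rightarrow> 'v set \<Rightarrow> ('v \<Rightarrow> 'v) \<Rightarrow> ('v \<Rightarrow> 'v) \<Rightarrow> ('v \<Rightarrow> 'v) \<Rightarrow>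
    ('v, 'k) tensor3 \<Rightarrow> ('v, 'k) tensor3"
  where "tmap3 s V A B C t =
    (\<lambda>f. if trilinear_on s (*) V f then t (\<lambda>u v w. f (A u) (B v) (C w)) else 0)"

definition tflip :: "('v, 'k) tensor2 \<Rightarrow> ('v, 'k) tensor2"
  where "tflip t = (\<lambda>f. t (\<lambda>u v. f v u))"

text \<open>The pairing of \<open>\<xi> \<otimes> \<eta>\<close> with a tensor, for linear forms \<open>\<xi>\<close> and \<open>\<eta>\<close>.\<close>

definition pairing :: "('v \<Rightarrow> 'k::field) \<Rightarrow> ('v \<Rightarrow> 'k) \<Rightarrow> ('v, 'k) tensor2 \<Rightarrow> 'k"
  where "pairing \<xi> \<eta> t = t (\<lambda>u v. \<xi> u * \<eta> v)"


section \<open>Mock-pre-Lie algebras and bialgebras\<close>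

definition mock_pre_lie_algebra ::
  "('k::field \<Rightarrow> 'v::ab_group_add \<Rightarrow> 'v) \<Rightarrow> 'v set \<Rightarrow> ('v \<Rightarrow> 'v \<Rightarrow> 'v) \<Rightarrow> bool"
  where "mock_pre_lie_algebra s V m \<longleftrightarrow>
    vector_space s \<and> module.subspace s V \<and>
    (\<forall>x\<in>V. \<forall>y\<in>V. m x y \<in> V) \<and> bilinear_on s s V m \<and>
    (\<forall>x\<in>V. \<forall>y\<in>V. \<forall>z\<in>V. m (m x y) z + m x (m y z) = - m (m y x) z - m y (m x z))"

definition Lm :: "('v \<Rightarrow> 'v \<Rightarrow> 'v) \<Rightarrow> 'v \<Rightarrow> 'v \<Rightarrow> 'v"
  where "Lm m x y = m x y"

definition Rm :: "('v \<Rightarrow> 'v \<Rightarrow> 'v) \<Rightarrow> 'v \<Rightarrow> 'v \<Rightarrow> 'v"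
  where "Rm m x y = m y x"

definition brace :: "('v \<Rightarrow> 'v \<Rightarrow> 'v::ab_group_add) \<Rightarrow> 'v \<Rightarrow> 'v \<Rightarrow> 'v"
  where "brace m x y = m x y + m y x"

text \<open>The product \<open>\<alpha>\<^sup>*\<close> on the dual space.\<close>

definition dual_product ::
  "('v \<Rightarrow> ('v, 'k::field) tensor2) \<Rightarrow> ('v \<Rightarrow> 'k) \<Rightarrow> ('v \<Rightarrow> 'k) \<Rightarrow> 'v \<Rightarrow> 'k"
  where "dual_product \<alpha> \<xi> \<eta> = (\<lambda>x. pairing \<xi> \<eta> (\<alpha> x))"

text \<open>
  The coproduct \<open>\<beta>\<close> on the dual space that is dual to the product \<open>m\<close>. Vectors \<open>x\<close> of \<open>g\<close> act as
  linear forms \<open>\<lambda>\<phi>. \<phi> x\<close> on the dual. Existence and uniqueness: \<open>dual_coproduct_ex1\<close> below.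
\<close>

definition dual_coproduct ::
  "('k::field \<Rightarrow> 'v::ab_group_add \<Rightarrow> 'v) \<Rightarrow> ('v \<Rightarrow> 'v \<Rightarrow> 'v) \<Rightarrow> ('v \<Rightarrow> 'k) \<Rightarrow> ('v \<Rightarrow> 'k, 'k) tensor2"
  where "dual_coproduct s m \<xi> =
    (THE t. t \<in> tensor_square fscale (dual s) \<and>
      (\<forall>x y. pairing (\<lambda>\<phi>. \<phi> x) (\<lambda>\<phi>. \<phi> y) t = \<xi> (m x y)))"

definition compatible ::
  "('k::field \<Rightarrow> 'v::ab_group_add \<Rightarrow> 'v) \<Rightarrow> 'v set \<Rightarrow> ('v \<Rightarrow> 'v \<Rightarrow> 'v) \<Rightarrow> ('v \<Rightarrow> ('v, 'k) tensor2) \<Rightarrow> bool"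
  where "compatible s V m \<delta> \<longleftrightarrow> (\<forall>x\<in>V. \<forall>y\<in>V.
    \<delta> (brace m x y) =
      - (tmap2 s V id (Rm m y + Lm m y) (\<delta> x) + tmap2 s V (Lm m y) id (\<delta> x))
      - (tmap2 s V id (Lm m x + Rm m x) (\<delta> y) + tmap2 s V (Lm m x) id (\<delta> y)))"

text \<open>
  \<open>(g, g\<^sup>*, \<alpha>, \<beta>)\<close> with \<open>\<beta>\<close> the dual of the product \<open>m\<close> of \<open>g\<close>. The product \<open>\<beta>\<^sup>*\<close> is \<open>m\<close> itself,
  under the identification of \<open>g\<close> with its bidual.
\<close>

definition mock_pre_lie_bialgebra ::
  "('k::field \<Rightarrow> 'v::ab_group_add \<Rightarrow> 'v) \<Rightarrow> ('v \<Rightarrow> 'v \<Rightarrow> 'v) \<Rightarrow> ('v \<Rightarrow> ('v, 'k) tensor2) \<Rightarrow> bool"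
  where "mock_pre_lie_bialgebra s m \<alpha> \<longleftrightarrow>
    (\<forall>x. \<alpha> x \<in> tensor_square s UNIV) \<and> linear_on s fscale UNIV \<alpha> \<and>
    mock_pre_lie_algebra s UNIV m \<and>
    mock_pre_lie_algebra fscale (dual s) (dual_product \<alpha>) \<and>
    compatible s UNIV m \<alpha> \<and>
    compatible fscale (dual s) (dual_product \<alpha>) (dual_coproduct s m)"


section \<open>The operators of the coboundary case\<close>

definition coboundary ::
  "('k::field \<Rightarrow> 'v::ab_group_add \<Rightarrow> 'v) \<Rightarrow> ('v \<Rightarrow> 'v \<Rightarrow> 'v) \<Rightarrow> ('v, 'k) tensor2 \<Rightarrow> 'v \<Rightarrow> ('v, 'k) tensor2"
  where "coboundary s m r x =
    tmap2 s UNIV id (Rm m x) r + tmap2 s UNIV id (Lm m x) r - tmap2 s UNIV (Lm m x) id r"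

definition P_plus ::
  "('k::field \<Rightarrow> 'v::ab_group_add \<Rightarrow> 'v) \<Rightarrow> ('v \<Rightarrow> 'v \<Rightarrow> 'v) \<Rightarrow> 'v \<Rightarrow> ('v, 'k) tensor2 \<Rightarrow> ('v, 'k) tensor2"
  where "P_plus s m x t = tmap2 s UNIV (Lm m x) id t + tmap2 s UNIV id (Lm m x) t"

definition P_minus ::
  "('k::field \<Rightarrow> 'v::ab_group_add \<Rightarrow> 'v) \<Rightarrow> ('v \<Rightarrow> 'v \<Rightarrow> 'v) \<Rightarrow> 'v \<Rightarrow> ('v, 'k) tensor2 \<Rightarrow> ('v, 'k) tensor2"
  where "P_minus s m x t = tmap2 s UNIV (Lm m x) id t - tmap2 s UNIV id (Lm m x) t"

definition Q_op ::
  "('k::field \<Rightarrow> 'v::ab_group_add \<Rightarrow> 'v) \<Rightarrow> ('v \<Rightarrow> 'v \<Rightarrow> 'v) \<Rightarrow> 'v \<Rightarrow> ('v, 'k) tensor3 \<Rightarrow> ('v, 'k) tensor3"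
  where "Q_op s m x t =
    tmap3 s UNIV (Lm m x) id id t + tmap3 s UNIV id (Lm m x) id t +
    tmap3 s UNIV id id (Rm m x) t + tmap3 s UNIV id id (Lm m x) t"

text \<open>
  \<open>[[r, r]]\<close>. Applying \<open>r = (\<Sum>i. a\<^sub>i \<otimes> b\<^sub>i)\<close> to a bilinear form \<open>h\<close> gives \<open>\<Sum>i. h a\<^sub>i b\<^sub>i\<close>, so
  the outer application of \<open>r\<close> below is the summation over \<open>i\<close>, with \<open>a = a\<^sub>i\<close> and \<open>b = b\<^sub>i\<close>, and
  the inner one is the summation over \<open>j\<close>, with \<open>a' = a\<^sub>j\<close> and \<open>b' = b\<^sub>j\<close>; the formula for a
  decomposed \<open>r\<close> is \<open>rr_bracket_decomposition\<close>.
\<close>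

definition rr_bracket ::
  "('k::field \<Rightarrow> 'v::ab_group_add \<Rightarrow> 'v) \<Rightarrow> ('v \<Rightarrow> 'v \<Rightarrow> 'v) \<Rightarrow> ('v, 'k) tensor2 \<Rightarrow> ('v, 'k) tensor3"
  where "rr_bracket s m r = (\<lambda>f. if trilinear_on s (*) UNIV f then
    r (\<lambda>a b. r (\<lambda>a' b'.
      - f (m a a') b' b - f b' (m a a') b + f a' (brace m a b') b
      + f (brace m a b') a' b - f a a' (brace m b b'))) else 0)"


section \<open>The tensor constructions are the expected ones\<close>

lemma vector_space_fscale: "vector_space (fscale :: 'k::field \<Rightarrow> _)"
  by unfold_locales (auto simp: fscale_def fun_eq_iff algebra_simps)

interpretation fs: vector_space "fscale :: 'k::field \<Rightarrow> ('b \<Rightarrow> 'k) \<Rightarrow> _"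
  by (rule vector_space_fscale)

lemma sum_fun_apply: "(\<Sum>i\<in>I. f i) x = (\<Sum>i\<in>I. f i x)"
  by (induction I rule: infinite_finite_induct) auto

lemma tens2_in: "u \<in> V \<Longrightarrow> v \<in> V \<Longrightarrow> tens2 s V u v \<in> tensor_square s V"
  unfolding tensor_square_def by (rule fs.span_base) auto

lemma tensor_square_induct [consumes 1, case_names zero step]:
  assumes "t \<in> tensor_square s V" and "P 0"
    and "\<And>c u v t. u \<in> V \<Longrightarrow> v \<in> V \<Longrightarrow> t \<in> tensor_square s V \<Longrightarrow> P t \<Longrightarrow> P (fscale c (tens2 s V u v) + t)"
  shows "P t"
proof -
  let ?S = "{tens2 s V u v | u v. u \<in> V \<and> v \<in> V}"
  have "t \<in> tensor_square s V \<and> P t"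
  proof (rule fs.span_induct_alt[of t ?S "\<lambda>t. t \<in> tensor_square s V \<and> P t"])
    show "t \<in> fs.span ?S" using assms(1) by (simp add: tensor_square_def)
    show "0 \<in> tensor_square s V \<and> P 0"
      using assms(2) by (simp add: tensor_square_def fs.span_zero)
    fix c x y assume x: "x \<in> ?S" and y: "y \<in> tensor_square s V \<and> P y"
    have "fscale c x + y \<in> fs.span ?S"
      using fs.span_add[OF fs.span_scale[OF fs.span_base[OF x]]] y
      by (simp only: tensor_square_def)
    then have "fscale c x + y \<in> tensor_square s V" by (simp only: tensor_square_def)
    then show "fscale c x + y \<in> tensor_square s V \<and> P (fscale c x + y)"
      using x y assms(3) by auto
  qed
  then show ?thesis by blast
qed

lemma bilinear_on_tens2:
  assumes "module.subspace s V" "vector_space s"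
  shows "bilinear_on s fscale V (tens2 s V)"
  by (auto simp: bilinear_on_def linear_on_def tens2_def fscale_def fun_eq_iff)

lemma linear_separates:
  assumes "vector_space (s :: 'k::field \<Rightarrow> 'w::ab_group_add \<Rightarrow> 'w)"
    and "\<And>\<phi>. \<phi> \<in> dual s \<Longrightarrow> \<phi> w = 0"
  shows "w = 0"
proof (rule ccontr)
  assume "w \<noteq> 0"
  interpret vector_space s by fact
  interpret P: vector_space_pair s "(*) :: 'k \<Rightarrow> 'k \<Rightarrow> 'k"
    by unfold_locales (auto simp: algebra_simps)
  have "\<not> dependent {w}" using \<open>w \<noteq> 0\<close> by simp
  from P.linear_independent_extend[OF this, of "\<lambda>_. 1"]
  obtain g where "Vector_Spaces.linear s (*) g" "g w = 1" by auto
  with assms(2)[of g] show False by (auto simp: dual_def)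
qed

theorem tensor_square_universal:
  fixes s :: "'k::field \<Rightarrow> 'v::ab_group_add \<Rightarrow> 'v" and s' :: "'k \<Rightarrow> 'w::ab_group_add \<Rightarrow> 'w"
  assumes s': "vector_space s'" and h: "bilinear_on s s' V h"
  shows "\<exists>F. linear_on fscale s' (tensor_square s V) F \<and>
    (\<forall>u\<in>V. \<forall>v\<in>V. F (tens2 s V u v) = h u v)"
proof -
  interpret W: vector_space s' by fact
  define R where "R t w \<longleftrightarrow> (\<forall>\<phi>\<in>dual s'. \<phi> w = t (\<lambda>u v. \<phi> (h u v)))" for t w
  have dadd: "\<phi> (x + y) = \<phi> x + \<phi> y" and dscale: "\<phi> (s' c x) = c * \<phi> x"
    if "\<phi> \<in> dual s'" for \<phi> x y c
    using that by (auto simp: dual_def Vector_Spaces.linear_iff)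
  have ddiff: "\<phi> (x - y) = \<phi> x - \<phi> y" if "\<phi> \<in> dual s'" for \<phi> x y
    using dadd[OF that, of "x - y" y] by simp
  have bil: "bilinear_on s (*) V (\<lambda>u v. \<phi> (h u v))" if "\<phi> \<in> dual s'" for \<phi>
    using h that by (auto simp: bilinear_on_def linear_on_def dadd dscale)
  have Rtens: "R (tens2 s V u v) (h u v)" for u v
    using bil by (auto simp: R_def tens2_def)
  have Radd: "R (t + t') (w + w')" if "R t w" "R t' w'" for t t' w w'
    using that by (auto simp: R_def dadd)
  have Rscale: "R (fscale c t) (s' c w)" if "R t w" for t w c
    using that by (auto simp: R_def dscale fscale_def)
  have Runique: "w = w'" if "R t w" "R t w'" for t w w'
    
  proof -
    have "\<phi> (w - w') = 0" if "\<phi> \<in> dual s'" for \<phi>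
      using \<open>R t w\<close> \<open>R t w'\<close> that by (auto simp: R_def ddiff)
    then have "w - w' = 0" by (rule linear_separates[OF s'])
    then show ?thesis by simp
  qed
  have Rex: "\<exists>w. R t w" if "t \<in> tensor_square s V" for t
    using that
  proof (induction rule: tensor_square_induct)
    case zero
    have "\<phi> 0 = 0" if "\<phi> \<in> dual s'" for \<phi>
      using ddiff[OF that, of 0 0] by simp
    then show ?case by (auto simp: R_def intro!: exI[of _ 0])
  next
    case (step c u v t)
    then obtain w where "R t w" by blast
    then show ?case using Radd[OF Rscale[OF Rtens]] by blast
  qed
  define F where "F t = (SOME w. R t w)" for t
  have F: "R t (F t)" if "t \<in> tensor_square s V" for t
    unfolding F_def using Rex[OF that] by (rule someI_ex)
  show ?thesis
  proof (intro exI[of _ F] conjI ballI)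
    show "linear_on fscale s' (tensor_square s V) F"
      unfolding linear_on_def
    proof (intro conjI ballI allI)
      fix t t' assume t: "t \<in> tensor_square s V" "t' \<in> tensor_square s V"
      then have "t + t' \<in> tensor_square s V"
        by (auto simp: tensor_square_def intro: fs.span_add)
      then show "F (t + t') = F t + F t'" by (rule Runique[OF F Radd[OF F[OF t(1)] F[OF t(2)]]])
    next
      fix c t assume t: "t \<in> tensor_square s V"
      then have "fscale c t \<in> tensor_square s V"
        by (auto simp: tensor_square_def intro: fs.span_scale)
      then show "F (fscale c t) = s' c (F t)" by (rule Runique[OF F Rscale[OF F[OF t]]])
    qed
  next
    fix u v assume "u \<in> V" "v \<in> V"
    then show "F (tens2 s V u v) = h u v" by (rule Runique[OF F[OF tens2_in] Rtens])
  qed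
qed

lemma tmap2_tens2:
  fixes s :: "'k::field \<Rightarrow> 'v::ab_group_add \<Rightarrow> 'v"
  assumes "linear_on s s V A" "A ` V \<subseteq> V" "linear_on s s V B" "B ` V \<subseteq> V"
  shows "tmap2 s V A B (tens2 s V u v) = tens2 s V (A u) (B v)"
proof (rule ext)
  fix f :: "'v \<Rightarrow> 'v \<Rightarrow> 'k"
  have "bilinear_on s (*) V (\<lambda>u v. f (A u) (B v))" if "bilinear_on s (*) V f"
    using that assms unfolding bilinear_on_def linear_on_def by (auto simp: image_subset_iff)
  then show "tmap2 s V A B (tens2 s V u v) f = tens2 s V (A u) (B v) f"
    by (auto simp: tmap2_def tens2_def)
qed

lemma tmap3_tens3:
  fixes s :: "'k::field \<Rightarrow> 'v::ab_group_add \<Rightarrow> 'v"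
  assumes "linear_on s s V A" "A ` V \<subseteq> V" "linear_on s s V B" "B ` V \<subseteq> V"
    "linear_on s s V C" "C ` V \<subseteq> V"
  shows "tmap3 s V A B C (tens3 s V u v w) = tens3 s V (A u) (B v) (C w)"
proof (rule ext)
  fix f :: "'v \<Rightarrow> 'v \<Rightarrow> 'v \<Rightarrow> 'k"
  have "trilinear_on s (*) V (\<lambda>u v w. f (A u) (B v) (C w))" if "trilinear_on s (*) V f"
    using that assms unfolding trilinear_on_def linear_on_def by (auto simp: image_subset_iff)
  then show "tmap3 s V A B C (tens3 s V u v w) f = tens3 s V (A u) (B v) (C w) f"
    by (auto simp: tmap3_def tens3_def)
qed

lemma tflip_tens2:
  fixes s :: "'k::field \<Rightarrow> 'v::ab_group_add \<Rightarrow> 'v"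
  shows "tflip (tens2 s V u v) = tens2 s V v u"
proof (rule ext)
  fix f :: "'v \<Rightarrow> 'v \<Rightarrow> 'k"
  have "bilinear_on s (*) V (\<lambda>u v. f v u) \<longleftrightarrow> bilinear_on s (*) V f"
    by (auto simp: bilinear_on_def)
  then show "tflip (tens2 s V u v) f = tens2 s V v u f"
    by (auto simp: tflip_def tens2_def)
qed

lemma tensor_square_decomposition:
  assumes "t \<in> tensor_square s V" "vector_space s" "module.subspace s V"
  shows "\<exists>(n::nat) a b. (\<forall>i<n. a i \<in> V \<and> b i \<in> V) \<and> t = (\<Sum>i<n. tens2 s V (a i) (b i))"
  using assms(1)
proof (induction rule: tensor_square_induct)
  case zero
  show ?case by (rule exI[of _ 0]) simp
next
  case (step c u v t)
  then obtain n :: nat and a b where n: "\<forall>i<n. a i \<in> V \<and> b i \<in> V"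
    and t: "t = (\<Sum>i<n. tens2 s V (a i) (b i))" by blast
  interpret vector_space s by fact
  have cu: "s c u \<in> V" using step assms(3) by (auto intro: subspace_scale)
  have "fscale c (tens2 s V u v) = tens2 s V (s c u) v"
    using bilinear_on_tens2[OF assms(3,2)] step by (auto simp: bilinear_on_def linear_on_def)
  moreover have "(\<Sum>i<n. tens2 s V ((a(n := s c u)) i) ((b(n := v)) i)) = t"
    unfolding t by (rule sum.cong) auto
  ultimately have "fscale c (tens2 s V u v) + t =
      (\<Sum>i<Suc n. tens2 s V ((a(n := s c u)) i) ((b(n := v)) i))"
    by (simp only: sum.lessThan_Suc fun_upd_same add.commute)
  moreover have "\<forall>i<Suc n. (a(n := s c u)) i \<in> V \<and> (b(n := v)) i \<in> V"
    using n cu step by (auto simp: less_Suc_eq)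
  ultimately show ?case by blast
qed

lemma tensor_square_off:
  assumes "t \<in> tensor_square s V" "\<not> bilinear_on s (*) V f"
  shows "t f = 0"
  using assms by (induction rule: tensor_square_induct) (auto simp: tens2_def fscale_def)

lemma tensor_square_sum:
  assumes "t \<in> tensor_square s V" "bilinear_on s (*) V f"
    and "\<And>i. i \<in> I \<Longrightarrow> bilinear_on s (*) V (g i)"
    and "\<And>u v. u \<in> V \<Longrightarrow> v \<in> V \<Longrightarrow> f u v = (\<Sum>i\<in>I. c i * g i u v)"
  shows "t f = (\<Sum>i\<in>I. c i * t (g i))"
  using assms(1)
proof (induction rule: tensor_square_induct)
  case zero show ?case by simp
next
  case (step d u v t)
  then show ?case using assms(2-4)
    by (simp add: tens2_def fscale_def sum.distrib sum_distrib_left algebra_simps)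
qed

theorem dual_coproduct_ex1:
  fixes s :: "'k::field \<Rightarrow> 'v::ab_group_add \<Rightarrow> 'v"
  assumes fd: "finite_dimensional_vector_space s B"
    and m: "bilinear_on s s UNIV m" and \<xi>: "\<xi> \<in> dual s"
  shows "\<exists>!t. t \<in> tensor_square fscale (dual s) \<and>
    (\<forall>x y. pairing (\<lambda>\<phi>. \<phi> x) (\<lambda>\<phi>. \<phi> y) t = \<xi> (m x y))"
proof -
  interpret finite_dimensional_vector_space s B by fact
  have VB: "\<not> dependent B" "span B = UNIV" "finite B"
    using independent_Basis span_Basis finite_Basis by auto
  define e where "e i x = representation B x i" for i x
  have e: "e i \<in> dual s" for i
    using VB vector_space_axioms
    by (auto simp: dual_def e_def Vector_Spaces.linear_iff vector_space_pair_def
        representation_add representation_scale vector_space_def algebra_simps)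
  have x: "x = (\<Sum>i\<in>B. s (e i x) i)" for x
    using sum_representation_eq[of B x B] VB by (simp add: e_def)
  have lin: "\<phi> (x + y) = \<phi> x + \<phi> y" "\<phi> (s c x) = c * \<phi> x" if "\<phi> \<in> dual s" for \<phi> x y c
    using that by (auto simp: dual_def Vector_Spaces.linear_iff)
  have lin0: "\<phi> 0 = 0" if "\<phi> \<in> dual s" for \<phi>
    using lin(1)[OF that, of 0 0] by (metis add_0 add_cancel_right_right)
  have linsum: "\<phi> (\<Sum>i\<in>I. h i) = (\<Sum>i\<in>I. \<phi> (h i))" if "\<phi> \<in> dual s" for \<phi> I and h :: "'v \<Rightarrow> 'v"
    using lin[OF that] lin0[OF that] by (induction I rule: infinite_finite_induct) auto
  have \<phi>x: "\<phi> x = (\<Sum>i\<in>B. e i x * \<phi> i)" if "\<phi> \<in> dual s" for \<phi> x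
    by (subst x) (simp add: linsum[OF that] lin[OF that])
  have bilev: "bilinear_on fscale (*) (dual s) (\<lambda>\<phi> \<psi>. \<phi> x * \<psi> y)" for x y
    by (auto simp: bilinear_on_def linear_on_def fscale_def algebra_simps)
  have sub: "fs.subspace (dual s)"
    using vector_space_axioms
    by (auto simp: fs.subspace_def dual_def fscale_def Vector_Spaces.linear_iff vector_space_pair_def
        vector_space_def algebra_simps)
  have \<phi>e: "\<phi> = (\<Sum>i\<in>B. fscale (\<phi> i) (e i))" if "\<phi> \<in> dual s" for \<phi>
  proof (rule ext)
    fix x
    show "\<phi> x = (\<Sum>i\<in>B. fscale (\<phi> i) (e i)) x"
      by (subst \<phi>x[OF that]) (simp add: sum_fun_apply fscale_def mult.commute)
  qed
  have fsum: "f (\<Sum>i\<in>I. fscale (c i) (e i)) = (\<Sum>i\<in>I. c i * f (e i))"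
    if f: "linear_on fscale (*) (dual s) f" for f c I
  proof -
    have "f (fscale 0 0) = 0 * f 0"
      using f fs.subspace_0[OF sub] unfolding linear_on_def by blast
    then have f0: "f 0 = 0" by simp
    show ?thesis
    proof (induction I rule: infinite_finite_induct)
      case (insert i I)
      have "(\<Sum>i\<in>I. fscale (c i) (e i)) \<in> dual s"
        by (intro fs.subspace_sum[OF sub] fs.subspace_scale[OF sub] e)
      then have "f (fscale (c i) (e i) + (\<Sum>i\<in>I. fscale (c i) (e i))) =
          c i * f (e i) + f (\<Sum>i\<in>I. fscale (c i) (e i))"
        using f e fs.subspace_scale[OF sub e] unfolding linear_on_def by metis
      then show ?case by (simp only: sum.insert[OF insert.hyps] insert.IH)
    next
      case empty
      show ?case using f0 by (simp only: sum.empty)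
    next
      case (infinite I)
      show ?case by (simp only: sum.infinite[OF infinite] f0)
    qed
  qed
  have fexp: "f \<phi> \<psi> = (\<Sum>(i, j)\<in>B \<times> B. f (e i) (e j) * (\<phi> i * \<psi> j))"
    if f: "bilinear_on fscale (*) (dual s) f" and "\<phi> \<in> dual s" "\<psi> \<in> dual s" for f \<phi> \<psi>
  proof -
    have "f \<phi> \<psi> = (\<Sum>i\<in>B. \<phi> i * f (e i) \<psi>)"
      using f that by (subst \<phi>e[OF that(2)], subst fsum) (auto simp: bilinear_on_def)
    also have "\<dots> = (\<Sum>i\<in>B. \<phi> i * (\<Sum>j\<in>B. \<psi> j * f (e i) (e j)))"
      using f e by (subst \<phi>e[OF that(3)], subst fsum) (auto simp: bilinear_on_def)
    finally show ?thesis
      by (simp add: sum.cartesian_product[symmetric] sum_distrib_left mult_ac)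
  qed
  define t where "t = (\<Sum>(i, j)\<in>B \<times> B. fscale (\<xi> (m i j)) (tens2 fscale (dual s) (e i) (e j)))"
  have m': "m (a + b) c = m a c + m b c" "m c (a + b) = m c a + m c b"
    "m (s k a) c = s k (m a c)" "m c (s k a) = s k (m c a)" for a b c k
    using m by (auto simp: bilinear_on_def linear_on_def)
  have d1: "(\<lambda>a. \<xi> (m a y)) \<in> dual s" and d2: "(\<lambda>a. \<xi> (m y a)) \<in> dual s" for y
    using \<xi> lin[OF \<xi>] by (auto simp: dual_def Vector_Spaces.linear_iff m')
  have subT: "fs.subspace (tensor_square fscale (dual s))"
    unfolding tensor_square_def by (rule fs.subspace_span)
  have t: "t \<in> tensor_square fscale (dual s)"
    unfolding t_def case_prod_unfold
    by (intro fs.subspace_sum[OF subT] fs.subspace_scale[OF subT] tens2_in e)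
  have ev: "pairing (\<lambda>\<phi>. \<phi> x) (\<lambda>\<phi>. \<phi> y) t = \<xi> (m x y)" for x y
  proof -
    have "\<xi> (m x y) = (\<Sum>i\<in>B. e i x * \<xi> (m i y))" by (rule \<phi>x[OF d1])
    also have "\<dots> = (\<Sum>i\<in>B. e i x * (\<Sum>j\<in>B. e j y * \<xi> (m i j)))" by (subst \<phi>x[OF d2]) simp
    also have "\<dots> = pairing (\<lambda>\<phi>. \<phi> x) (\<lambda>\<phi>. \<phi> y) t"
      using bilev by (simp add: pairing_def t_def sum_fun_apply case_prod_unfold fscale_def tens2_def
          sum.cartesian_product[symmetric] sum_distrib_left mult_ac)
        (simp add: sum.cartesian_product case_prod_unfold)
    finally show ?thesis by simp
  qed
  have uniq: "t1 = t2"
    if t1: "t1 \<in> tensor_square fscale (dual s)" and t2: "t2 \<in> tensor_square fscale (dual s)"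
      and eq: "\<And>x y. pairing (\<lambda>\<phi>. \<phi> x) (\<lambda>\<phi>. \<phi> y) t1 = pairing (\<lambda>\<phi>. \<phi> x) (\<lambda>\<phi>. \<phi> y) t2" for t1 t2
  proof (rule ext)
    fix f
    show "t1 f = t2 f"
    proof (cases "bilinear_on fscale (*) (dual s) f")
      case False
      then show ?thesis by (simp only: tensor_square_off[OF t1 False] tensor_square_off[OF t2 False])
    next
      case True
      have ex: "t' f = (\<Sum>p\<in>B \<times> B. f (e (fst p)) (e (snd p)) * t' (\<lambda>\<phi> \<psi>. \<phi> (fst p) * \<psi> (snd p)))"
        if "t' \<in> tensor_square fscale (dual s)" for t'
        using fexp[OF True] by (intro tensor_square_sum[OF that True bilev]) (simp add: case_prod_unfold)
      show ?thesis by (simp only: ex[OF t1] ex[OF t2] eq[unfolded pairing_def])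
    qed
  qed
  show ?thesis
  proof (rule ex1I[of _ t])
    show "t \<in> tensor_square fscale (dual s) \<and> (\<forall>x y. pairing (\<lambda>\<phi>. \<phi> x) (\<lambda>\<phi>. \<phi> y) t = \<xi> (m x y))"
      using t ev by blast
  next
    fix t'
    assume "t' \<in> tensor_square fscale (dual s) \<and> (\<forall>x y. pairing (\<lambda>\<phi>. \<phi> x) (\<lambda>\<phi>. \<phi> y) t' = \<xi> (m x y))"
    then have t': "t' \<in> tensor_square fscale (dual s)"
      and ev': "pairing (\<lambda>\<phi>. \<phi> x) (\<lambda>\<phi>. \<phi> y) t' = \<xi> (m x y)" for x y
      by blast+
    show "t' = t" by (rule uniq[OF t' t]) (simp only: ev ev')
  qed
qed

lemma rr_bracket_decomposition:
  assumes m: "bilinear_on s s UNIV m" and r: "r = (\<Sum>i\<in>I. tens2 s UNIV (a i) (b i))"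
  shows "rr_bracket s m r = (\<Sum>i\<in>I. \<Sum>j\<in>I.
    - tens3 s UNIV (m (a i) (a j)) (b j) (b i) - tens3 s UNIV (b j) (m (a i) (a j)) (b i)
    + tens3 s UNIV (a j) (brace m (a i) (b j)) (b i)
    + tens3 s UNIV (brace m (a i) (b j)) (a j) (b i)
    - tens3 s UNIV (a i) (a j) (brace m (b i) (b j)))"
proof (rule ext)
  fix f
  show "rr_bracket s m r f = (\<Sum>i\<in>I. \<Sum>j\<in>I.
    - tens3 s UNIV (m (a i) (a j)) (b j) (b i) - tens3 s UNIV (b j) (m (a i) (a j)) (b i)
    + tens3 s UNIV (a j) (brace m (a i) (b j)) (b i)
    + tens3 s UNIV (brace m (a i) (b j)) (a j) (b i)
    - tens3 s UNIV (a i) (a j) (brace m (b i) (b j))) f"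
  proof (cases "trilinear_on s (*) UNIV f")
    case False
    then show ?thesis by (simp add: rr_bracket_def sum_fun_apply tens3_def)
  next
    case True
    define h where "h x y x' y' =
      - f (m x x') y' y - f y' (m x x') y + f x' (brace m x y') y
      + f (brace m x y') x' y - f x x' (brace m y y')" for x y x' y'
    have ev: "r k = (\<Sum>i\<in>I. k (a i) (b i))" if "bilinear_on s (*) UNIV k" for k
      using that by (simp add: r sum_fun_apply tens2_def)
    have f: "f (x + x') y z = f x y z + f x' y z" "f y (x + x') z = f y x z + f y x' z"
      "f y z (x + x') = f y z x + f y z x'" "f (s c x) y z = c * f x y z"
      "f y (s c x) z = c * f y x z" "f y z (s c x) = c * f y z x" for x x' y z c
      using True by (auto simp: trilinear_on_def linear_on_def)
    have m': "m (x + x') y = m x y + m x' y" "m y (x + x') = m y x + m y x'"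
      "m (s c x) y = s c (m x y)" "m y (s c x) = s c (m y x)" for x x' y c
      using m by (auto simp: bilinear_on_def linear_on_def)
    have b1: "bilinear_on s (*) UNIV (h x y)" for x y
      by (auto simp: bilinear_on_def linear_on_def h_def brace_def f m' algebra_simps)
    have b2: "bilinear_on s (*) UNIV (\<lambda>x y. \<Sum>j\<in>I. h x y (a j) (b j))"
      by (auto simp: bilinear_on_def linear_on_def h_def brace_def f m' algebra_simps
          sum.distrib sum_distrib_left sum_subtractf)
    have "rr_bracket s m r f = r (\<lambda>x y. r (h x y))"
      using True by (simp add: rr_bracket_def h_def[abs_def])
    also have "\<dots> = (\<Sum>i\<in>I. \<Sum>j\<in>I. h (a i) (b i) (a j) (b j))"
      using ev[OF b1] ev[OF b2] by simp
    finally show ?thesis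
      using True by (simp add: sum_fun_apply tens3_def h_def)
  qed
qed

end

theory Submission
  imports Defs
begin

text \<open>
  Write \<open>d = r - \<tau>(r)\<close> and \<open>W(x, y) = [P\<^sub>-(x \<cdot> y) + P\<^sub>+(x) P\<^sub>-(y)] d\<close>. The compatibility of \<open>\<alpha>\<close> with
  the product of \<open>g\<close> is automatic for a coboundary, since \<open>L\<close> and \<open>L + R\<close> turn \<open>{x, y}\<close>
  into minus the anticommutator of operators. The compatibility of \<open>\<beta>\<close> at \<open>\<xi>, \<eta>\<close>, evaluated at \<open>x \<otimes> y\<close>, fails exactly
  by \<open>\<langle>\<xi> \<otimes> \<eta>, W(x, y)\<rangle>\<close>, which is condition (i). The mock-pre-Lie identity of \<open>g\<^sup>*\<close> says that
  \<open>(1 + \<tau>\<^sub>1\<^sub>2)(\<alpha> \<otimes> Id + Id \<otimes> \<alpha>) \<alpha>(x)\<close> vanishes, and this tensor equals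
  \<open>Q(x)[[r, r]] + (\<Sum>j. W(x, a\<^sub>j) \<otimes> b\<^sub>j)\<close>; so, once (i) holds, it is condition (ii).
\<close>

text \<open>A decomposition of \<open>r\<close> into pure tensors is fixed, so that every expression
  in \<open>r\<close> becomes a finite sum over indices and the identities can be checked on
  summands.\<close>

locale mock_pre_lie_coboundary = finite_dimensional_vector_space s B
  for s :: "'k::field_char_0 \<Rightarrow> 'v::ab_group_add \<Rightarrow> 'v" and B :: "'v set" +
  fixes m :: "'v \<Rightarrow> 'v \<Rightarrow> 'v" and r :: "('v, 'k) tensor2"
    and n :: nat and a b :: "nat \<Rightarrow> 'v"
  assumes mpl: "mock_pre_lie_algebra s UNIV m"
    and r_eq: "r = (\<Sum>i<n. tens2 s UNIV (a i) (b i))"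
begin

abbreviation "bil f \<equiv> bilinear_on s (*) UNIV f"
abbreviation "tril f \<equiv> trilinear_on s (*) UNIV f"
abbreviation "\<alpha> \<equiv> coboundary s m r"
abbreviation "dp \<equiv> dual_product \<alpha>"

section \<open>Identities in the algebra and rules for multilinear forms\<close>

lemma bil_m: "bilinear_on s s UNIV m"
  using mpl by (simp add: mock_pre_lie_algebra_def)

lemma m_simps:
  "m (x + y) z = m x z + m y z" "m z (x + y) = m z x + m z y"
  "m (s c x) z = s c (m x z)" "m z (s c x) = s c (m z x)"
  using bil_m by (auto simp: bilinear_on_def linear_on_def)

lemma m_minus: "m (- x) z = - m x z" "m z (- x) = - m z x"
  using m_simps(3)[of "-1" x z] m_simps(4)[of z "-1" x] by simp_all

lemma m_diff: "m (x - y) z = m x z - m y z" "m z (x - y) = m z x - m z y"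
  using m_simps(1)[of x "- y" z] m_simps(2)[of z x "- y"] by (simp_all add: m_minus)

text \<open>The defining identity, solved for one of its terms. As a general rewrite rule it would
  loop, so below it is instantiated at the pairs of letters whose order is to be reversed.\<close>

lemma m_swap: "m (m y x) z = - m (m x y) z - m x (m y z) - m y (m x z)"
proof -
  have *: "m (m x y) z + m x (m y z) = - m (m y x) z - m y (m x z)"
    using mpl by (simp add: mock_pre_lie_algebra_def)
  have "m (m y x) z = - (m (m x y) z + m x (m y z)) - m y (m x z)"
    by (simp only: *) simp
  also have "\<dots> = - m (m x y) z - m x (m y z) - m y (m x z)" by simp
  finally show ?thesis .
qed

lemma brace_left_mult: "m (brace m x y) z = - m x (m y z) - m y (m x z)"
  by (simp add: brace_def m_simps m_swap[of x y])

text \<open>The commutative product \<open>brace\<close> is mock-Lie (Jacobi-Jordan). Together with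
  \<open>brace_left_mult\<close> this gives the two anticommutator rules that a coboundary
  needs.\<close>

lemma brace_jacobi: "brace m (brace m x y) z = - brace m x (brace m y z) - brace m y (brace m x z)"
  by (simp only: brace_def m_simps m_swap[of x y] m_swap[of x z] m_swap[of y z])
    (simp add: algebra_simps)

lemma bil_simps:
  assumes "bil f"
  shows "f (x + y) z = f x z + f y z" "f z (x + y) = f z x + f z y"
    "f (s c x) z = c * f x z" "f z (s c x) = c * f z x"
    "f (- x) z = - f x z" "f z (- x) = - f z x"
    "f (x - y) z = f x z - f y z" "f z (x - y) = f z x - f z y"
proof -
  show 1: "f (x + y) z = f x z + f y z" "f z (x + y) = f z x + f z y"
    "f (s c x) z = c * f x z" "f z (s c x) = c * f z x" for x y z c
    using assms by (auto simp: bilinear_on_def linear_on_def)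
  show 2: "f (- x) z = - f x z" "f z (- x) = - f z x" for x z
    using 1(3)[of "-1" x z] 1(4)[of z "-1" x] by simp_all
  show "f (x - y) z = f x z - f y z" "f z (x - y) = f z x - f z y"
    using 1(1)[of x "- y" z] 1(2)[of z x "- y"] by (simp_all add: 2)
qed

lemma tril_simps:
  assumes "tril f"
  shows "f (x + y) z w = f x z w + f y z w" "f z (x + y) w = f z x w + f z y w"
    "f z w (x + y) = f z w x + f z w y"
    "f (s c x) z w = c * f x z w" "f z (s c x) w = c * f z x w" "f z w (s c x) = c * f z w x"
    "f (- x) z w = - f x z w" "f z (- x) w = - f z x w" "f z w (- x) = - f z w x"
    "f (x - y) z w = f x z w - f y z w" "f z (x - y) w = f z x w - f z y w"
    "f z w (x - y) = f z w x - f z w y"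
proof -
  show 1: "f (x + y) z w = f x z w + f y z w" "f z (x + y) w = f z x w + f z y w"
    "f z w (x + y) = f z w x + f z w y"
    "f (s c x) z w = c * f x z w" "f z (s c x) w = c * f z x w" "f z w (s c x) = c * f z w x"
    for x y z w c
    using assms by (auto simp: trilinear_on_def linear_on_def)
  show 2: "f (- x) z w = - f x z w" "f z (- x) w = - f z x w" "f z w (- x) = - f z w x" for x z w
    using 1(4)[of "-1" x z w] 1(5)[of z "-1" x w] 1(6)[of z w "-1" x] by simp_all
  show "f (x - y) z w = f x z w - f y z w" "f z (x - y) w = f z x w - f z y w"
    "f z w (x - y) = f z w x - f z w y"
    using 1(1)[of x "- y" z w] 1(2)[of z x "- y" w] 1(3)[of z w x "- y"] by (simp_all add: 2)
qed

lemma r_eval: "bil f \<Longrightarrow> r f = (\<Sum>i<n. f (a i) (b i))"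
  by (simp add: r_eq sum_fun_apply tens2_def)

lemma bil_comp:
  assumes "bil f"
  shows "bil (\<lambda>u v. f (m x u) v)" "bil (\<lambda>u v. f u (m x v))" "bil (\<lambda>u v. f u (m v x))"
    "bil (\<lambda>u v. f v u)"
  by (auto simp: bilinear_on_def linear_on_def bil_simps[OF assms] m_simps)

section \<open>The coboundary map \<alpha> and its compatibility with the product of g\<close>

lemma coboundary_eval:
  assumes "bil f"
  shows "\<alpha> x f = (\<Sum>i<n. f (a i) (brace m x (b i)) - f (m x (a i)) (b i))"
  using assms
  by (simp add: coboundary_def tmap2_def Lm_def Rm_def id_def r_eval bil_comp bil_simps brace_def
      sum.distrib sum_subtractf)

lemma coboundary_off: "\<not> bil f \<Longrightarrow> \<alpha> x f = 0"
  by (simp add: coboundary_def tmap2_def)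

lemma coboundary_tens:
  "\<alpha> x = (\<Sum>i<n. tens2 s UNIV (a i) (brace m x (b i)) - tens2 s UNIV (m x (a i)) (b i))"
proof (rule ext)
  fix f
  show "\<alpha> x f = (\<Sum>i<n. tens2 s UNIV (a i) (brace m x (b i)) - tens2 s UNIV (m x (a i)) (b i)) f"
    by (cases "bil f") (simp_all add: coboundary_eval coboundary_off sum_fun_apply tens2_def)
qed

lemma coboundary_in_tensor_square: "\<alpha> x \<in> tensor_square s UNIV"
proof -
  have sub: "fs.subspace (tensor_square s UNIV)"
    unfolding tensor_square_def by (rule fs.subspace_span)
  show ?thesis
    unfolding coboundary_tens by (intro fs.subspace_sum[OF sub] fs.subspace_diff[OF sub] tens2_in) auto
qed

lemma coboundary_linear: "linear_on s fscale UNIV \<alpha>"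
  unfolding linear_on_def
proof (intro conjI ballI allI)
  fix x y
  show "\<alpha> (x + y) = \<alpha> x + \<alpha> y"
  proof (rule ext)
    fix f show "\<alpha> (x + y) f = (\<alpha> x + \<alpha> y) f"
      by (cases "bil f") (simp_all add: coboundary_eval coboundary_off brace_def m_simps bil_simps
          algebra_simps sum.distrib sum_subtractf)
  qed
next
  fix c x
  show "\<alpha> (s c x) = fscale c (\<alpha> x)"
  proof (rule ext)
    fix f show "\<alpha> (s c x) f = fscale c (\<alpha> x) f"
      by (cases "bil f") (simp_all add: coboundary_eval coboundary_off brace_def m_simps bil_simps
          algebra_simps sum.distrib sum_subtractf fscale_def sum_distrib_left)
  qed
qed

text \<open>On the right side the mixed terms, where \<open>x\<close> acts on one leg of
  \<open>r\<close> and \<open>y\<close> on the other, cancel between the contributions of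
  \<open>\<alpha> x\<close> and \<open>\<alpha> y\<close>. What remains acts on a single leg and is
  rewritten by \<open>brace_jacobi\<close> or \<open>brace_left_mult\<close>.\<close>

lemma coboundary_compatible: "compatible s UNIV m \<alpha>"
  unfolding compatible_def
proof (intro ballI ext)
  fix x y and f :: "'v \<Rightarrow> 'v \<Rightarrow> 'k"
  let ?rhs = "- (tmap2 s UNIV id (Rm m y + Lm m y) (\<alpha> x) + tmap2 s UNIV (Lm m y) id (\<alpha> x))
      - (tmap2 s UNIV id (Lm m x + Rm m x) (\<alpha> y) + tmap2 s UNIV (Lm m x) id (\<alpha> y))"
  show "\<alpha> (brace m x y) f = ?rhs f"
  proof (cases "bil f")
    case False
    then show ?thesis by (simp add: coboundary_off tmap2_def)
  next
    case True
    note F = bil_simps[OF True]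
    have *: "bil (\<lambda>u v. f u (m x v + m v x))" "bil (\<lambda>u v. f u (m v x + m x v))" for x
      by (auto simp: bilinear_on_def linear_on_def F m_simps algebra_simps)
    have "?rhs f = - (\<alpha> x (\<lambda>u v. f u (m v y + m y v)) + \<alpha> x (\<lambda>u v. f (m y u) v))
       - (\<alpha> y (\<lambda>u v. f u (m x v + m v x)) + \<alpha> y (\<lambda>u v. f (m x u) v))"
      using True by (simp add: tmap2_def Lm_def Rm_def id_def)
    also have "\<dots> = (\<Sum>i<n. f (a i) (brace m (brace m x y) (b i)) - f (m (brace m x y) (a i)) (b i))"
      unfolding coboundary_eval[OF *(1)] coboundary_eval[OF *(2)] coboundary_eval[OF bil_comp(1)[OF True]]
        sum.distrib[symmetric] sum_subtractf[symmetric] sum_negf[symmetric]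
      unfolding brace_jacobi[of x y] brace_left_mult[of x y]
      by (intro sum.cong refl) (simp add: F brace_def m_simps algebra_simps)
    finally show ?thesis by (simp only: coboundary_eval[OF True])
  qed
qed

section \<open>Conditions (i) and (ii) as vanishing sums\<close>

text \<open>
  \<open>P_sum x y f\<close> is the value on \<open>f\<close> of \<open>W(x, y)\<close>; \<open>P_form\<close>, \<open>bracket_form\<close>, \<open>Q_form\<close>, \<open>assoc_form\<close> and
  \<open>mock_form\<close> below are single summands, with \<open>(u, v) = (a\<^sub>i, b\<^sub>i)\<close> and \<open>(u', v') = (a\<^sub>j, b\<^sub>j)\<close>:
  \<open>assoc_form\<close> of \<open>(\<alpha> \<otimes> Id + Id \<otimes> \<alpha>) \<alpha>(x)\<close>, and \<open>mock_form\<close> of its image under \<open>1 + \<tau>\<^sub>1\<^sub>2\<close>.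
\<close>

definition P_form :: "'v \<Rightarrow> 'v \<Rightarrow> ('v \<Rightarrow> 'v \<Rightarrow> 'k) \<Rightarrow> 'v \<Rightarrow> 'v \<Rightarrow> 'k"
  where "P_form x y f u v = f (m (m x y) u) v - f u (m (m x y) v) +
    (f (m x (m y u)) v - f (m x u) (m y v) + f (m y u) (m x v) - f u (m x (m y v)))"

definition P_sum :: "'v \<Rightarrow> 'v \<Rightarrow> ('v \<Rightarrow> 'v \<Rightarrow> 'k) \<Rightarrow> 'k"
  where "P_sum x y f = (\<Sum>i<n. P_form x y f (a i) (b i) - P_form x y f (b i) (a i))"

text \<open>A tensor is a function on forms. This one is 0 off the bilinear forms by construction,
  so only its values on bilinear forms matter.\<close>

lemma cond_i_iff:
  "P_minus s m (m x y) (r - tflip r) + P_plus s m x (P_minus s m y (r - tflip r)) = 0 \<longleftrightarrow>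
    (\<forall>f. bil f \<longrightarrow> P_sum x y f = 0)" (is "?T = 0 \<longleftrightarrow> _")
proof -
  have off: "?T f = 0" if "\<not> bil f" for f
    using that by (simp add: P_minus_def P_plus_def tmap2_def)
  have on: "?T f = P_sum x y f" if f: "bil f" for f
  proof -
    \<comment> \<open>Folding the difference into \<open>t\<close> keeps it a single functional, so
      that each of the six terms below is evaluated by \<open>d\<close>.\<close>
    define t where "t = r - tflip r"
    have d: "t g = (\<Sum>i<n. g (a i) (b i) - g (b i) (a i))" if "bil g" for g
      using that by (simp add: t_def tflip_def r_eval bil_comp sum_subtractf)
    note c1 = bil_comp(1)[OF f] and c2 = bil_comp(2)[OF f]
    have c: "bil (\<lambda>u v. f (m x (m y u)) v)" "bil (\<lambda>u v. f (m x u) (m y v))"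
      "bil (\<lambda>u v. f (m y u) (m x v))" "bil (\<lambda>u v. f u (m x (m y v)))"
      by (auto simp: bilinear_on_def linear_on_def bil_simps[OF f] m_simps)
    have "?T f = (t (\<lambda>u v. f (m (m x y) u) v) - t (\<lambda>u v. f u (m (m x y) v))) +
      ((t (\<lambda>u v. f (m x (m y u)) v) - t (\<lambda>u v. f (m x u) (m y v)))
       + (t (\<lambda>u v. f (m y u) (m x v)) - t (\<lambda>u v. f u (m x (m y v)))))"
      using f c1 c2 by (simp add: P_minus_def P_plus_def tmap2_def Lm_def id_def t_def[symmetric])
    also have "\<dots> = P_sum x y f"
      unfolding d[OF c1] d[OF c2] d[OF c(1)] d[OF c(2)] d[OF c(3)] d[OF c(4)] P_sum_def P_form_def
        sum.distrib[symmetric] sum_subtractf[symmetric]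
      by (intro sum.cong refl) (simp add: algebra_simps)
    finally show ?thesis .
  qed
  have "?T = 0 \<longleftrightarrow> (\<forall>f. ?T f = 0)"
    by (simp only: fun_eq_iff zero_fun_apply)
  also have "\<dots> \<longleftrightarrow> (\<forall>f. bil f \<longrightarrow> ?T f = 0)"
    using off by blast
  also have "\<dots> \<longleftrightarrow> (\<forall>f. bil f \<longrightarrow> P_sum x y f = 0)"
    by (simp only: on cong: imp_cong)
  finally show ?thesis .
qed

definition bracket_form :: "('v \<Rightarrow> 'v \<Rightarrow> 'v \<Rightarrow> 'k) \<Rightarrow> 'v \<Rightarrow> 'v \<Rightarrow> 'v \<Rightarrow> 'v \<Rightarrow> 'k"
  where "bracket_form f u v u' v' =
      - f (m u u') v' v - f v' (m u u') v + f u' (brace m u v') v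
      + f (brace m u v') u' v - f u u' (brace m v v')"

definition Q_form :: "'v \<Rightarrow> ('v \<Rightarrow> 'v \<Rightarrow> 'v \<Rightarrow> 'k) \<Rightarrow> 'v \<Rightarrow> 'v \<Rightarrow> 'v \<Rightarrow> 'v \<Rightarrow> 'k"
  where "Q_form x f u v u' v' =
    bracket_form (\<lambda>p q w. f (m x p) q w) u v u' v' + bracket_form (\<lambda>p q w. f p (m x q) w) u v u' v' +
    bracket_form (\<lambda>p q w. f p q (brace m x w)) u v u' v'"

lemma rr_bracket_eval:
  assumes "tril f"
  shows "rr_bracket s m r f = (\<Sum>i<n. \<Sum>j<n. bracket_form f (a i) (b i) (a j) (b j))"
  using assms unfolding rr_bracket_decomposition[OF bil_m r_eq]
  by (simp add: sum_fun_apply tens3_def bracket_form_def)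

lemma cond_ii_iff:
  "Q_op s m x (rr_bracket s m r) = 0 \<longleftrightarrow>
    (\<forall>f. tril f \<longrightarrow> (\<Sum>i<n. \<Sum>j<n. Q_form x f (a i) (b i) (a j) (b j)) = 0)" (is "?T = 0 \<longleftrightarrow> _")
proof -
  have off: "?T f = 0" if "\<not> tril f" for f
    using that by (simp add: Q_op_def tmap3_def)
  have on: "?T f = (\<Sum>i<n. \<Sum>j<n. Q_form x f (a i) (b i) (a j) (b j))" if f: "tril f" for f
  proof -
    have c: "tril (\<lambda>u v w. f (m x u) v w)" "tril (\<lambda>u v w. f u (m x v) w)"
      "tril (\<lambda>u v w. f u v (m x w))" "tril (\<lambda>u v w. f u v (m w x))"
      by (auto simp: trilinear_on_def linear_on_def tril_simps[OF f] m_simps)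
    define t where "t = rr_bracket s m r"
    have "?T f = t (\<lambda>u v w. f (m x u) v w) + t (\<lambda>u v w. f u (m x v) w) +
      t (\<lambda>u v w. f u v (m w x)) + t (\<lambda>u v w. f u v (m x w))"
      using f by (simp add: Q_op_def tmap3_def Lm_def Rm_def id_def t_def[symmetric])
    also have "\<dots> = (\<Sum>i<n. \<Sum>j<n. Q_form x f (a i) (b i) (a j) (b j))"
      unfolding t_def rr_bracket_eval[OF c(1)] rr_bracket_eval[OF c(2)] rr_bracket_eval[OF c(3)]
        rr_bracket_eval[OF c(4)] sum.distrib[symmetric]
      by (intro sum.cong refl) (simp add: Q_form_def bracket_form_def brace_def tril_simps[OF f] m_simps)
    finally show ?thesis .
  qed
  have "?T = 0 \<longleftrightarrow> (\<forall>f. ?T f = 0)"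
    by (simp only: fun_eq_iff zero_fun_apply)
  also have "\<dots> \<longleftrightarrow> (\<forall>f. tril f \<longrightarrow> ?T f = 0)"
    using off by blast
  also have "\<dots> \<longleftrightarrow> (\<forall>f. tril f \<longrightarrow> (\<Sum>i<n. \<Sum>j<n. Q_form x f (a i) (b i) (a j) (b j)) = 0)"
    by (simp only: on cong: imp_cong)
  finally show ?thesis .
qed

section \<open>The identity relating \<open>mock_form\<close>, \<open>Q_form\<close> and
  \<open>P_sum\<close>\<close>

definition assoc_form :: "'v \<Rightarrow> ('v \<Rightarrow> 'v \<Rightarrow> 'v \<Rightarrow> 'k) \<Rightarrow> 'v \<Rightarrow> 'v \<Rightarrow> 'v \<Rightarrow> 'v \<Rightarrow> 'k"
  where "assoc_form x f u v u' v' =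
    (f u' (brace m u v') (brace m x v) - f (m u u') v' (brace m x v))
    - (f u' (brace m (m x u) v') v - f (m (m x u) u') v' v)
    + (f u u' (brace m (brace m x v) v') - f u (m (brace m x v) u') v')
    - (f (m x u) u' (brace m v v') - f (m x u) (m v u') v')"

definition mock_form :: "'v \<Rightarrow> ('v \<Rightarrow> 'v \<Rightarrow> 'v \<Rightarrow> 'k) \<Rightarrow> 'v \<Rightarrow> 'v \<Rightarrow> 'v \<Rightarrow> 'v \<Rightarrow> 'k"
  where "mock_form x f u v u' v' = assoc_form x f u v u' v' + assoc_form x (\<lambda>p q w. f q p w) u v u' v'"

text \<open>
  The summands agree only after symmetrizing in \<open>i\<close> and \<open>j\<close>. Rewriting with the mock-pre-Lie
  identity on a fixed order of each pair of letters brings both sides to the same normal form.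
\<close>

lemma mock_form_symmetrized:
  fixes x
  assumes f: "tril f"
  defines "D \<equiv> \<lambda>u v u' v'. mock_form x f u v u' v' - Q_form x f u v u' v'
    - (P_form x u' (\<lambda>p q. f p q v') u v - P_form x u' (\<lambda>p q. f p q v') v u)"
  shows "D u v u' v' + D u' v' u v = 0"
  unfolding D_def mock_form_def assoc_form_def Q_form_def bracket_form_def P_form_def brace_def
  \<comment> \<open>There is no swap for the pairs \<open>u\<close>, \<open>v\<close> and
    \<open>u'\<close>, \<open>v'\<close>, since the two legs of one copy of \<open>r\<close> are
    never multiplied. After the expansion, signs are pushed to the monomials, the sum is sorted, and
    the negative monomials are collected into one subtracted sum; the claim is then an equality of
    two identical sums.\<close>
  by (simp only: m_simps m_minus m_diff tril_simps[OF f] m_swap[of u x] m_swap[of v x]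
        m_swap[of u' x] m_swap[of v' x] m_swap[of u u'] m_swap[of u v'] m_swap[of v u'] m_swap[of v v'],
      simp only: diff_conv_add_uminus minus_add_distrib minus_minus,
      simp only: algebra_simps,
      simp only: minus_add_distrib[symmetric],
      simp only: add_uminus_conv_diff add_diff_eq right_minus_eq)

lemma mock_form_eq:
  assumes f: "tril f"
  shows "(\<Sum>i<n. \<Sum>j<n. mock_form x f (a i) (b i) (a j) (b j)) =
    (\<Sum>i<n. \<Sum>j<n. Q_form x f (a i) (b i) (a j) (b j)) + (\<Sum>j<n. P_sum x (a j) (\<lambda>p q. f p q (b j)))"
proof -
  define D where "D i j = mock_form x f (a i) (b i) (a j) (b j) - Q_form x f (a i) (b i) (a j) (b j)
    - (P_form x (a j) (\<lambda>p q. f p q (b j)) (a i) (b i) - P_form x (a j) (\<lambda>p q. f p q (b j)) (b i) (a i))" for i j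
  \<comment> \<open>Exchanging the indices in one copy turns twice the sum of \<open>D\<close> into
    the sum of \<open>D i j + D j i\<close>, which vanishes; characteristic 0 allows the division by
    2.\<close>
  have "(\<Sum>i<n. \<Sum>j<n. D i j) + (\<Sum>i<n. \<Sum>j<n. D i j) = (\<Sum>i<n. \<Sum>j<n. D i j) + (\<Sum>i<n. \<Sum>j<n. D j i)"
    by (subst (4) sum.swap) simp
  also have "\<dots> = (\<Sum>i<n. \<Sum>j<n. D i j + D j i)"
    by (simp only: sum.distrib)
  also have "\<dots> = 0"
    unfolding D_def mock_form_symmetrized[OF f] by simp
  finally have "2 * (\<Sum>i<n. \<Sum>j<n. D i j) = 0" by simp
  then have D: "(\<Sum>i<n. \<Sum>j<n. D i j) = 0" by simp
  have "(\<Sum>j<n. P_sum x (a j) (\<lambda>p q. f p q (b j))) = (\<Sum>i<n. \<Sum>j<n.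
      P_form x (a j) (\<lambda>p q. f p q (b j)) (a i) (b i) - P_form x (a j) (\<lambda>p q. f p q (b j)) (b i) (a i))"
    unfolding P_sum_def by (rule sum.swap)
  moreover have "(\<Sum>i<n. \<Sum>j<n. mock_form x f (a i) (b i) (a j) (b j)) - (\<Sum>i<n. \<Sum>j<n. Q_form x f (a i) (b i) (a j) (b j))
    - (\<Sum>i<n. \<Sum>j<n.
      P_form x (a j) (\<lambda>p q. f p q (b j)) (a i) (b i) - P_form x (a j) (\<lambda>p q. f p q (b j)) (b i) (a i)) = 0"
    using D by (simp only: D_def sum_subtractf)
  ultimately show ?thesis by (simp only: right_minus_eq diff_eq_eq add_0_left add_0_right add.commute)
qed

section \<open>The dual space and its product\<close>

lemma dual_simps:
  assumes "\<xi> \<in> dual s"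
  shows "\<xi> (x + y) = \<xi> x + \<xi> y" "\<xi> (s c x) = c * \<xi> x" "\<xi> (- x) = - \<xi> x" "\<xi> (x - y) = \<xi> x - \<xi> y"
    "\<xi> (\<Sum>i\<in>I. g i) = (\<Sum>i\<in>I. \<xi> (g i))"
proof -
  interpret \<xi>: Vector_Spaces.linear s "(*)" \<xi> using assms by (simp add: dual_def)
  show "\<xi> (x + y) = \<xi> x + \<xi> y" "\<xi> (s c x) = c * \<xi> x" "\<xi> (- x) = - \<xi> x" "\<xi> (x - y) = \<xi> x - \<xi> y"
    "\<xi> (\<Sum>i\<in>I. g i) = (\<Sum>i\<in>I. \<xi> (g i))"
    by (rule \<xi>.add \<xi>.scale \<xi>.neg \<xi>.diff \<xi>.sum)+
qed

lemma dualI: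
  assumes "\<And>x y. \<xi> (x + y) = \<xi> x + \<xi> y" "\<And>c x. \<xi> (s c x) = c * \<xi> x"
  shows "\<xi> \<in> dual s"
  using assms vector_space_axioms
  by (auto simp: dual_def Vector_Spaces.linear_iff vector_space_pair_def vector_space_def algebra_simps)

lemma dual_subspace: "fs.subspace (dual s)"
  by (auto simp: fs.subspace_def dual_simps fscale_def algebra_simps intro!: dualI)

lemma dual_prod_bil: "\<xi> \<in> dual s \<Longrightarrow> \<eta> \<in> dual s \<Longrightarrow> bil (\<lambda>u v. \<xi> u * \<eta> v)"
  by (auto simp: bilinear_on_def linear_on_def dual_simps algebra_simps)

lemma dual_prod_tril:
  "\<xi> \<in> dual s \<Longrightarrow> \<eta> \<in> dual s \<Longrightarrow> \<zeta> \<in> dual s \<Longrightarrow> tril (\<lambda>u v w. \<xi> u * \<eta> v * \<zeta> w)"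
  by (auto simp: trilinear_on_def linear_on_def dual_simps algebra_simps)

lemma dual_mult: "\<xi> \<in> dual s \<Longrightarrow> (\<lambda>v. \<xi> (m x v)) \<in> dual s" "\<xi> \<in> dual s \<Longrightarrow> (\<lambda>v. \<xi> (m v x)) \<in> dual s"
  by (auto intro!: dualI simp: dual_simps m_simps)

lemma dp_eval:
  assumes "\<xi> \<in> dual s" "\<eta> \<in> dual s"
  shows "dp \<xi> \<eta> x = (\<Sum>i<n. \<xi> (a i) * \<eta> (brace m x (b i)) - \<xi> (m x (a i)) * \<eta> (b i))"
  by (simp add: dual_product_def pairing_def coboundary_eval[OF dual_prod_bil[OF assms]])

text \<open>Linearity in the vector argument is that of \<alpha>, read off on one fixed
  form.\<close>

lemma dp_in: "dp \<xi> \<eta> \<in> dual s"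
  using coboundary_linear
  by (intro dualI) (auto simp: dual_product_def pairing_def linear_on_def fscale_def)

lemma fscale_apply: "fscale c f x = c * f x"
  by (simp add: fscale_def)

lemma dp_bilinear: "bilinear_on fscale fscale (dual s) dp"
  unfolding bilinear_on_def linear_on_def
  by (auto simp: fun_eq_iff dp_eval fs.subspace_add[OF dual_subspace] fs.subspace_scale[OF dual_subspace]
      fscale_apply algebra_simps sum.distrib sum_subtractf sum_distrib_left)

text \<open>The outer index \<open>i\<close> comes from \<alpha> at \<open>x\<close>, and the inner
  index \<open>j\<close> from \<alpha> applied once more to a leg of the term that \<open>i\<close>
  contributes.\<close>

lemma dp_assoc_form:
  assumes d: "\<xi> \<in> dual s" "\<eta> \<in> dual s" "\<zeta> \<in> dual s"
  shows "dp (dp \<xi> \<eta>) \<zeta> x + dp \<xi> (dp \<eta> \<zeta>) x =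
    (\<Sum>i<n. \<Sum>j<n. assoc_form x (\<lambda>p q w. \<xi> p * \<eta> q * \<zeta> w) (a i) (b i) (a j) (b j))"
  unfolding dp_eval[OF dp_in d(3)] dp_eval[OF d(1) dp_in] dp_eval[OF d(1,2)] dp_eval[OF d(2,3)]
    sum_distrib_left sum_distrib_right sum.distrib[symmetric] sum_subtractf[symmetric]
  by (intro sum.cong refl) (simp add: assoc_form_def algebra_simps)

text \<open>Closure and bilinearity of \<open>dp\<close> hold for every \<open>r\<close>, so only
  the defining identity remains. Exchanging \<xi> and \<eta> in it is the exchange of the first two
  arguments in \<open>mock_form\<close>.\<close>

lemma dual_mock_pre_lie_iff:
  "mock_pre_lie_algebra fscale (dual s) dp \<longleftrightarrow>
    (\<forall>\<xi>\<in>dual s. \<forall>\<eta>\<in>dual s. \<forall>\<zeta>\<in>dual s. \<forall>x.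
      (\<Sum>i<n. \<Sum>j<n. mock_form x (\<lambda>p q w. \<xi> p * \<eta> q * \<zeta> w) (a i) (b i) (a j) (b j)) = 0)"
proof -
  have *: "(\<Sum>i<n. \<Sum>j<n. mock_form x (\<lambda>p q w. \<xi> p * \<eta> q * \<zeta> w) (a i) (b i) (a j) (b j)) =
      dp (dp \<xi> \<eta>) \<zeta> x + dp \<xi> (dp \<eta> \<zeta>) x + (dp (dp \<eta> \<xi>) \<zeta> x + dp \<eta> (dp \<xi> \<zeta>) x)"
    if "\<xi> \<in> dual s" "\<eta> \<in> dual s" "\<zeta> \<in> dual s" for \<xi> \<eta> \<zeta> x
    using that by (simp add: dp_assoc_form mock_form_def sum.distrib mult.commute mult.left_commute)
  have "dp (dp \<xi> \<eta>) \<zeta> + dp \<xi> (dp \<eta> \<zeta>) = - dp (dp \<eta> \<xi>) \<zeta> - dp \<eta> (dp \<xi> \<zeta>) \<longleftrightarrow>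
      (\<forall>x. (\<Sum>i<n. \<Sum>j<n. mock_form x (\<lambda>p q w. \<xi> p * \<eta> q * \<zeta> w) (a i) (b i) (a j) (b j)) = 0)"
    if "\<xi> \<in> dual s" "\<eta> \<in> dual s" "\<zeta> \<in> dual s" for \<xi> \<eta> \<zeta>
    unfolding *[OF that] fun_eq_iff by (simp add: eq_neg_iff_add_eq_0 algebra_simps)
  then show ?thesis
    using dual_subspace dp_in dp_bilinear
    by (simp add: mock_pre_lie_algebra_def vector_space_fscale)
qed

section \<open>Reduction of arbitrary forms to products of linear forms\<close>

lemma dual_basis:
  obtains e where "\<And>i. e i \<in> dual s" "\<And>x. x = (\<Sum>i\<in>B. s (e i x) i)"
proof
  have VB: "\<not> dependent B" "span B = UNIV" "finite B"
    using independent_Basis span_Basis finite_Basis by auto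
  show "(\<lambda>x. representation B x i) \<in> dual s" for i
    using VB by (intro dualI) (auto simp: representation_add representation_scale)
  show "x = (\<Sum>i\<in>B. s (representation B x i) i)" for x
    using sum_representation_eq[of B x B] VB by simp
qed

text \<open>\<open>P_sum\<close> is a formula that makes sense for every function of two vectors and
  is linear in that function. An expansion of a form can therefore be carried through it;
  \<open>mock_form_linear\<close> serves the same end.\<close>

lemma P_sum_linear:
  "P_sum x y (\<lambda>u v. \<Sum>p\<in>P. c p * g p u v) = (\<Sum>p\<in>P. c p * P_sum x y (g p))"
proof (induction P rule: infinite_finite_induct)
  case (insert p P)
  have "P_sum x y (\<lambda>u v. c p * g p u v + h u v) = c p * P_sum x y (g p) + P_sum x y h" for h
    unfolding P_sum_def sum_distrib_left sum.distrib[symmetric]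
    by (intro sum.cong refl) (simp add: P_form_def algebra_simps)
  then show ?case using insert by simp
qed (simp_all add: P_sum_def P_form_def)

lemma mock_form_linear:
  "(\<Sum>i<n. \<Sum>j<n. mock_form x (\<lambda>u v w. \<Sum>p\<in>P. c p * g p u v w) (a i) (b i) (a j) (b j)) =
    (\<Sum>p\<in>P. c p * (\<Sum>i<n. \<Sum>j<n. mock_form x (g p) (a i) (b i) (a j) (b j)))"
proof (induction P rule: infinite_finite_induct)
  case (insert p P)
  have "(\<Sum>i<n. \<Sum>j<n. mock_form x (\<lambda>u v w. c p * g p u v w + h u v w) (a i) (b i) (a j) (b j)) =
    c p * (\<Sum>i<n. \<Sum>j<n. mock_form x (g p) (a i) (b i) (a j) (b j)) +
    (\<Sum>i<n. \<Sum>j<n. mock_form x h (a i) (b i) (a j) (b j))" for h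
    unfolding sum_distrib_left sum.distrib[symmetric]
    by (intro sum.cong refl) (simp add: mock_form_def assoc_form_def algebra_simps)
  then show ?case using insert by simp
qed (simp_all add: mock_form_def assoc_form_def)

text \<open>In finite dimension a bilinear form is a combination of products of coordinate
  functionals, with its values on basis pairs as coefficients. The duals of pure tensors thus detect
  everything; \<open>mock_form_zero_iff\<close> is the trilinear analogue.\<close>

lemma P_sum_zero_iff:
  "(\<forall>f. bil f \<longrightarrow> P_sum x y f = 0) \<longleftrightarrow>
    (\<forall>\<xi>\<in>dual s. \<forall>\<eta>\<in>dual s. P_sum x y (\<lambda>u v. \<xi> u * \<eta> v) = 0)"
proof (intro iffI allI impI)
  fix f assume R: "\<forall>\<xi>\<in>dual s. \<forall>\<eta>\<in>dual s. P_sum x y (\<lambda>u v. \<xi> u * \<eta> v) = 0" and f: "bil f"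
  obtain e where e: "\<And>i. e i \<in> dual s" "\<And>x. x = (\<Sum>i\<in>B. s (e i x) i)" using dual_basis by blast
  have l: "(\<lambda>u. f u v) \<in> dual s" "(\<lambda>u. f v u) \<in> dual s" for v
    by (auto intro!: dualI simp: bil_simps[OF f])
  define c where "c p = f (fst p) (snd p)" for p
  define g where "g p = (\<lambda>u v. e (fst p) u * e (snd p) v)" for p
  have "f u v = (\<Sum>p\<in>B \<times> B. c p * g p u v)" for u v
  proof -
    have "f u v = (\<Sum>i\<in>B. \<Sum>j\<in>B. e i u * (e j v * f i j))"
      by (subst e(2)[of u], subst dual_simps(5)[OF l(1)], subst e(2)[of v], subst dual_simps(5)[OF l(2)])
        (simp add: bil_simps[OF f] mult_ac)
    then show ?thesis by (simp add: c_def g_def sum.cartesian_product case_prod_unfold mult_ac)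
  qed
  then have "f = (\<lambda>u v. \<Sum>p\<in>B \<times> B. c p * g p u v)"
    by (intro ext)
  then have "P_sum x y f = (\<Sum>p\<in>B \<times> B. c p * P_sum x y (g p))"
    by (simp only: P_sum_linear)
  then show "P_sum x y f = 0" using R e by (simp add: g_def)
qed (auto intro: dual_prod_bil)

lemma mock_form_zero_iff:
  "(\<forall>f. tril f \<longrightarrow> (\<Sum>i<n. \<Sum>j<n. mock_form x f (a i) (b i) (a j) (b j)) = 0) \<longleftrightarrow>
    (\<forall>\<xi>\<in>dual s. \<forall>\<eta>\<in>dual s. \<forall>\<zeta>\<in>dual s.
      (\<Sum>i<n. \<Sum>j<n. mock_form x (\<lambda>p q w. \<xi> p * \<eta> q * \<zeta> w) (a i) (b i) (a j) (b j)) = 0)"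
    (is "?L \<longleftrightarrow> ?R")
proof (intro iffI allI impI)
  fix f assume R: ?R and f: "tril f"
  obtain e where e: "\<And>i. e i \<in> dual s" "\<And>x. x = (\<Sum>i\<in>B. s (e i x) i)" using dual_basis by blast
  define c where "c p = f (fst p) (fst (snd p)) (snd (snd p))" for p
  define g where "g p = (\<lambda>u v w. e (fst p) u * e (fst (snd p)) v * e (snd (snd p)) w)" for p
  have l: "(\<lambda>u. f u v w) \<in> dual s" "(\<lambda>u. f v u w) \<in> dual s" "(\<lambda>u. f v w u) \<in> dual s" for v w
    by (auto intro!: dualI simp: tril_simps[OF f])
  have "f u v w = (\<Sum>p\<in>B \<times> B \<times> B. c p * g p u v w)" for u v w
  proof -
    have "f u v w = (\<Sum>i\<in>B. \<Sum>j\<in>B. \<Sum>k\<in>B. e i u * (e j v * (e k w * f i j k)))"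
      by (subst e(2)[of u], subst dual_simps(5)[OF l(1)], subst e(2)[of v], subst dual_simps(5)[OF l(2)],
          subst e(2)[of w], subst dual_simps(5)[OF l(3)])
        (simp add: tril_simps[OF f] mult_ac)
    then show ?thesis by (simp add: c_def g_def sum.cartesian_product case_prod_unfold mult_ac)
  qed
  then have "f = (\<lambda>u v w. \<Sum>p\<in>B \<times> B \<times> B. c p * g p u v w)"
    by (intro ext)
  then have "(\<Sum>i<n. \<Sum>j<n. mock_form x f (a i) (b i) (a j) (b j)) =
      (\<Sum>p\<in>B \<times> B \<times> B. c p * (\<Sum>i<n. \<Sum>j<n. mock_form x (g p) (a i) (b i) (a j) (b j)))"
    by (simp only: mock_form_linear)
  then show "(\<Sum>i<n. \<Sum>j<n. mock_form x f (a i) (b i) (a j) (b j)) = 0"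
    using R e by (simp add: g_def)
qed (auto intro: dual_prod_tril)

section \<open>The coproduct \<beta> and its compatibility with the dual product\<close>

lemma dual_coproduct:
  assumes "\<xi> \<in> dual s"
  shows "dual_coproduct s m \<xi> \<in> tensor_square fscale (dual s)"
    "pairing (\<lambda>\<phi>. \<phi> x) (\<lambda>\<phi>. \<phi> y) (dual_coproduct s m \<xi>) = \<xi> (m x y)"
  using theI'[OF dual_coproduct_ex1[OF finite_dimensional_vector_space_axioms bil_m assms]]
  unfolding dual_coproduct_def by blast+

lemma tensor_square_dual_subspace: "fs.subspace (tensor_square fscale (dual s))"
  unfolding tensor_square_def by (rule fs.subspace_span)

lemma dual_tensor_eq_iff:
  assumes t: "t1 \<in> tensor_square fscale (dual s)" "t2 \<in> tensor_square fscale (dual s)"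
  shows "t1 = t2 \<longleftrightarrow>
    (\<forall>x y. pairing (\<lambda>\<phi>. \<phi> x) (\<lambda>\<phi>. \<phi> y) t1 = pairing (\<lambda>\<phi>. \<phi> x) (\<lambda>\<phi>. \<phi> y) t2)"
proof (intro iffI)
  assume eq: "\<forall>x y. pairing (\<lambda>\<phi>. \<phi> x) (\<lambda>\<phi>. \<phi> y) t1 = pairing (\<lambda>\<phi>. \<phi> x) (\<lambda>\<phi>. \<phi> y) t2"
  \<comment> \<open>For the zero product and the zero functional, the uniqueness of the coproduct
    says that a tensor over the dual with all pairings zero is itself zero. This is then applied to
    \<open>t1 - t2\<close>.\<close>
  have "bilinear_on s s UNIV (\<lambda>_ _. 0)"
    by (auto simp: bilinear_on_def linear_on_def)
  from dual_coproduct_ex1[OF finite_dimensional_vector_space_axioms this, of "\<lambda>_. 0"]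
  have "\<exists>!t. t \<in> tensor_square fscale (dual s) \<and>
      (\<forall>x y. pairing (\<lambda>\<phi>. \<phi> x) (\<lambda>\<phi>. \<phi> y) t = 0)"
    by (simp add: dualI)
  moreover have "t1 - t2 \<in> tensor_square fscale (dual s)"
    by (rule fs.subspace_diff[OF tensor_square_dual_subspace t])
  moreover have "\<forall>x y. pairing (\<lambda>\<phi>. \<phi> x) (\<lambda>\<phi>. \<phi> y) (t1 - t2) = 0"
    using eq by (simp add: pairing_def)
  moreover have "0 \<in> tensor_square fscale (dual s)"
    by (rule fs.subspace_0[OF tensor_square_dual_subspace])
  moreover have "\<forall>x y. pairing (\<lambda>\<phi>. \<phi> x) (\<lambda>\<phi>. \<phi> y) (0 :: ('v \<Rightarrow> 'k, 'k) tensor2) = 0"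
    by (simp add: pairing_def)
  ultimately have "t1 - t2 = 0" by blast
  then show "t1 = t2" by (simp only: right_minus_eq)
qed simp

lemma tmap2_in:
  assumes "t \<in> tensor_square fscale (dual s)"
    and A: "linear_on fscale fscale (dual s) A" "A ` dual s \<subseteq> dual s"
    and C: "linear_on fscale fscale (dual s) C" "C ` dual s \<subseteq> dual s"
  shows "tmap2 fscale (dual s) A C t \<in> tensor_square fscale (dual s)"
  using assms(1)
proof (induction rule: tensor_square_induct)
  case zero
  have "tmap2 fscale (dual s) A C 0 = 0" by (simp add: tmap2_def fun_eq_iff)
  then show ?case by (simp only: fs.subspace_0[OF tensor_square_dual_subspace])
next
  case (step c u v t)
  have "tmap2 fscale (dual s) A C (fscale c (tens2 fscale (dual s) u v) + t) =
      fscale c (tmap2 fscale (dual s) A C (tens2 fscale (dual s) u v)) + tmap2 fscale (dual s) A C t"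
    by (simp add: tmap2_def fun_eq_iff fscale_apply)
  also have "\<dots> = fscale c (tens2 fscale (dual s) (A u) (C v)) + tmap2 fscale (dual s) A C t"
    by (simp only: tmap2_tens2[OF A C])
  also have "\<dots> \<in> tensor_square fscale (dual s)"
    using step A C
    by (intro fs.subspace_add[OF tensor_square_dual_subspace] fs.subspace_scale[OF tensor_square_dual_subspace]
        tens2_in) auto
  finally show ?case .
qed

lemma eval_bil: "bilinear_on fscale (*) (dual s) (\<lambda>\<phi> \<psi>. \<phi> x * \<psi> y)"
  by (auto simp: bilinear_on_def linear_on_def fscale_apply algebra_simps)

text \<open>The hypotheses say that \<open>A\<close> and \<open>C\<close> are, at \<open>x\<close>
  and \<open>y\<close>, transposed to replacing these vectors by \<open>u\<close> and
  \<open>v\<close>.\<close>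

lemma pairing_tmap2:
  assumes t: "t \<in> tensor_square fscale (dual s)"
    and A: "\<And>\<phi>. \<phi> \<in> dual s \<Longrightarrow> A \<phi> x = \<phi> u" and C: "\<And>\<phi>. \<phi> \<in> dual s \<Longrightarrow> C \<phi> y = \<phi> v"
  shows "pairing (\<lambda>\<phi>. \<phi> x) (\<lambda>\<phi>. \<phi> y) (tmap2 fscale (dual s) A C t) =
    pairing (\<lambda>\<phi>. \<phi> u) (\<lambda>\<phi>. \<phi> v) t"
proof -
  have "bilinear_on fscale (*) (dual s) (\<lambda>\<phi> \<psi>. A \<phi> x * C \<psi> y)"
    by (auto simp: bilinear_on_def linear_on_def fscale_apply A C algebra_simps
        fs.subspace_add[OF dual_subspace] fs.subspace_scale[OF dual_subspace])
  \<comment> \<open>The two forms are known to agree only on \<open>dual s\<close>. A sum over a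
    one-element index set lets \<open>tensor_square_sum\<close> conclude that \<open>t\<close> has
    the same value on both.\<close>
  then have "t (\<lambda>\<phi> \<psi>. A \<phi> x * C \<psi> y) = (\<Sum>i\<in>{()}. 1 * t (\<lambda>\<phi> \<psi>. \<phi> u * \<psi> v))"
    by (rule tensor_square_sum[OF t]) (simp_all add: eval_bil A C)
  then show ?thesis by (simp add: pairing_def tmap2_def eval_bil)
qed

text \<open>Multiplying by a fixed functional and evaluating at \<open>x\<close> is again evaluation
  at a vector. The witness is the tensor \<open>\<alpha> x\<close> contracted with \<eta> in one
  leg.\<close>

lemma dp_rep:
  assumes "\<eta> \<in> dual s"
  shows "\<exists>v. \<forall>\<phi>\<in>dual s. dp \<eta> \<phi> x = \<phi> v" "\<exists>v. \<forall>\<phi>\<in>dual s. dp \<phi> \<eta> x = \<phi> v"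
proof -
  show "\<exists>v. \<forall>\<phi>\<in>dual s. dp \<eta> \<phi> x = \<phi> v"
    by (rule exI[of _ "\<Sum>i<n. s (\<eta> (a i)) (brace m x (b i)) - s (\<eta> (m x (a i))) (b i)"])
      (simp add: dp_eval assms dual_simps)
  show "\<exists>v. \<forall>\<phi>\<in>dual s. dp \<phi> \<eta> x = \<phi> v"
    by (rule exI[of _ "\<Sum>i<n. s (\<eta> (brace m x (b i))) (a i) - s (\<eta> (b i)) (m x (a i))"])
      (simp add: dp_eval assms dual_simps mult.commute)
qed

text \<open>If evaluating \<open>C \<phi>\<close> at \<open>y\<close> is evaluation of \<phi> at
  \<open>v\<close>, the pairing equals \<open>\<xi> (m x v)\<close>. Reading this as the functional
  \<open>\<lambda>w. \<xi> (m x w)\<close> at \<open>v\<close> trades \<open>v\<close> back for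
  \<open>C\<close> and \<open>y\<close>. \<open>pairing_left\<close> does the same in the other
  leg.\<close>

lemma pairing_right:
  assumes \<xi>: "\<xi> \<in> dual s" and C: "\<And>y. \<exists>v. \<forall>\<phi>\<in>dual s. C \<phi> y = \<phi> v"
  shows "pairing (\<lambda>\<phi>. \<phi> x) (\<lambda>\<phi>. \<phi> y) (tmap2 fscale (dual s) id C (dual_coproduct s m \<xi>)) =
    C (\<lambda>w. \<xi> (m x w)) y"
proof -
  obtain v where v: "\<forall>\<phi>\<in>dual s. C \<phi> y = \<phi> v" using C by blast
  then show ?thesis
    using pairing_tmap2[OF dual_coproduct(1)[OF \<xi>], of id x x C y v] dual_coproduct(2)[OF \<xi>]
    by (simp add: dual_mult \<xi>)
qed

lemma pairing_left:
  assumes \<xi>: "\<xi> \<in> dual s" and A: "\<And>y. \<exists>v. \<forall>\<phi>\<in>dual s. A \<phi> y = \<phi> v"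
  shows "pairing (\<lambda>\<phi>. \<phi> x) (\<lambda>\<phi>. \<phi> y) (tmap2 fscale (dual s) A id (dual_coproduct s m \<xi>)) =
    A (\<lambda>w. \<xi> (m w y)) x"
proof -
  obtain u where u: "\<forall>\<phi>\<in>dual s. A \<phi> x = \<phi> u" using A by blast
  then show ?thesis
    using pairing_tmap2[OF dual_coproduct(1)[OF \<xi>], of A x u id y y] dual_coproduct(2)[OF \<xi>]
    by (simp add: dual_mult \<xi>)
qed

text \<open>Both sides of the compatibility lie in the tensor square of the dual, so by
  \<open>dual_tensor_eq_iff\<close> they may be compared through their pairings with all
  \<open>x\<close> and \<open>y\<close>.\<close>

lemma dual_compatible_iff:
  "compatible fscale (dual s) dp (dual_coproduct s m) \<longleftrightarrow>
    (\<forall>\<xi>\<in>dual s. \<forall>\<eta>\<in>dual s. \<forall>x y. P_sum x y (\<lambda>u v. \<xi> u * \<eta> v) = 0)"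
proof -
  let ?D = "dual s" and ?\<beta> = "dual_coproduct s m"
  let ?rhs = "\<lambda>\<xi> \<eta>. - (tmap2 fscale ?D id (Rm dp \<eta> + Lm dp \<eta>) (?\<beta> \<xi>) + tmap2 fscale ?D (Lm dp \<eta>) id (?\<beta> \<xi>))
      - (tmap2 fscale ?D id (Lm dp \<xi> + Rm dp \<xi>) (?\<beta> \<eta>) + tmap2 fscale ?D (Lm dp \<xi>) id (?\<beta> \<eta>))"
  have "?\<beta> (brace dp \<xi> \<eta>) = ?rhs \<xi> \<eta> \<longleftrightarrow> (\<forall>x y. P_sum x y (\<lambda>u v. \<xi> u * \<eta> v) = 0)"
    if \<xi>: "\<xi> \<in> ?D" and \<eta>: "\<eta> \<in> ?D" for \<xi> \<eta>
  proof -
    \<comment> \<open>Both orders are provided because \<open>compatible\<close> writes right plus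
      left multiplication in one place and left plus right in another.\<close>
    have sum_lin: "linear_on fscale fscale ?D (A + C)" "linear_on fscale fscale ?D (C + A)"
      if "linear_on fscale fscale ?D A" "linear_on fscale fscale ?D C" for A C
      using that by (auto simp: linear_on_def fs.scale_right_distrib algebra_simps)
    have lin: "linear_on fscale fscale ?D (Lm dp \<phi>)" "linear_on fscale fscale ?D (Rm dp \<phi>)" if "\<phi> \<in> ?D" for \<phi>
      using dp_bilinear that by (auto simp: bilinear_on_def Lm_def Rm_def[abs_def] linear_on_def)
    have lin_id: "linear_on fscale fscale ?D id" by (simp add: linear_on_def)
    have im: "Lm dp \<phi> ` ?D \<subseteq> ?D" "Rm dp \<phi> ` ?D \<subseteq> ?D" "(Lm dp \<phi> + Rm dp \<phi>) ` ?D \<subseteq> ?D"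
      "(Rm dp \<phi> + Lm dp \<phi>) ` ?D \<subseteq> ?D" "id ` ?D \<subseteq> ?D" for \<phi>
      by (auto simp: Lm_def Rm_def dp_in intro!: fs.subspace_add[OF dual_subspace])
    have brace_in: "brace dp \<xi> \<eta> \<in> ?D"
      unfolding brace_def by (intro fs.subspace_add[OF dual_subspace] dp_in)
    have rhs: "?rhs \<xi> \<eta> \<in> tensor_square fscale ?D"
      by (intro fs.subspace_add fs.subspace_diff fs.subspace_neg tensor_square_dual_subspace tmap2_in
          dual_coproduct lin lin_id im sum_lin \<xi> \<eta>)
    have rep: "\<exists>v. \<forall>\<phi>\<in>?D. Lm dp \<eta> \<phi> x = \<phi> v" "\<exists>v. \<forall>\<phi>\<in>?D. (Lm dp \<eta> + Rm dp \<eta>) \<phi> x = \<phi> v"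
      "\<exists>v. \<forall>\<phi>\<in>?D. (Rm dp \<eta> + Lm dp \<eta>) \<phi> x = \<phi> v" if d: "\<eta> \<in> ?D" for \<eta> x
    proof -
      obtain u v where "\<forall>\<phi>\<in>?D. dp \<eta> \<phi> x = \<phi> u" "\<forall>\<phi>\<in>?D. dp \<phi> \<eta> x = \<phi> v"
        using dp_rep[OF d] by metis
      then show "\<exists>v. \<forall>\<phi>\<in>?D. Lm dp \<eta> \<phi> x = \<phi> v" "\<exists>v. \<forall>\<phi>\<in>?D. (Lm dp \<eta> + Rm dp \<eta>) \<phi> x = \<phi> v"
        "\<exists>v. \<forall>\<phi>\<in>?D. (Rm dp \<eta> + Lm dp \<eta>) \<phi> x = \<phi> v"
        by (auto simp: Lm_def Rm_def dual_simps intro: exI[of _ u] exI[of _ "u + v"])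
    qed
    have pr: "pairing (\<lambda>\<phi>. \<phi> x) (\<lambda>\<phi>. \<phi> y) (?rhs \<xi> \<eta>) =
      - (dp (\<lambda>w. \<xi> (m x w)) \<eta> y + dp \<eta> (\<lambda>w. \<xi> (m x w)) y + dp \<eta> (\<lambda>w. \<xi> (m w y)) x)
      - (dp \<xi> (\<lambda>w. \<eta> (m x w)) y + dp (\<lambda>w. \<eta> (m x w)) \<xi> y + dp \<xi> (\<lambda>w. \<eta> (m w y)) x)" for x y
    proof -
      have "pairing (\<lambda>\<phi>. \<phi> x) (\<lambda>\<phi>. \<phi> y) (- (t1 + t2) - (t3 + t4)) =
        - (pairing (\<lambda>\<phi>. \<phi> x) (\<lambda>\<phi>. \<phi> y) t1 + pairing (\<lambda>\<phi>. \<phi> x) (\<lambda>\<phi>. \<phi> y) t2)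
        - (pairing (\<lambda>\<phi>. \<phi> x) (\<lambda>\<phi>. \<phi> y) t3 + pairing (\<lambda>\<phi>. \<phi> x) (\<lambda>\<phi>. \<phi> y) t4)"
        for t1 t2 t3 t4 :: "('v \<Rightarrow> 'k, 'k) tensor2"
        by (simp add: pairing_def)
      then show ?thesis
        by (simp only: pairing_right[OF \<xi> rep(3)[OF \<eta>]] pairing_left[OF \<xi> rep(1)[OF \<eta>]]
            pairing_right[OF \<eta> rep(2)[OF \<xi>]] pairing_left[OF \<eta> rep(1)[OF \<xi>]])
          (simp add: Lm_def Rm_def)
    qed
    \<comment> \<open>This holds for each index separately. The products
      \<open>m (m x (b i)) y\<close>, \<open>m (m (b i) x) y\<close>, \<open>m x (m (b i) y)\<close>
      and \<open>m (b i) (m x y)\<close> cancel by the mock-pre-Lie identity, and the surviving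
      terms form \<open>P_form\<close>.\<close>
    have "brace dp \<xi> \<eta> (m x y) - pairing (\<lambda>\<phi>. \<phi> x) (\<lambda>\<phi>. \<phi> y) (?rhs \<xi> \<eta>) = - P_sum x y (\<lambda>u v. \<xi> u * \<eta> v)" for x y
      unfolding pr P_sum_def brace_def[of dp] plus_fun_apply
        dp_eval[OF \<xi> \<eta>] dp_eval[OF \<eta> \<xi>] dp_eval[OF dual_mult(1)[OF \<xi>] \<eta>] dp_eval[OF \<eta> dual_mult(1)[OF \<xi>]]
        dp_eval[OF \<eta> dual_mult(2)[OF \<xi>]] dp_eval[OF dual_mult(1)[OF \<eta>] \<xi>] dp_eval[OF \<xi> dual_mult(1)[OF \<eta>]]
        dp_eval[OF \<xi> dual_mult(2)[OF \<eta>]] sum.distrib[symmetric] sum_subtractf[symmetric] sum_negf[symmetric]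
    proof (intro sum.cong refl, goal_cases)
      case (1 i)
      show ?case
        by (simp add: P_form_def brace_def m_simps m_swap[of x "b i"] dual_simps[OF \<xi>] dual_simps[OF \<eta>] algebra_simps)
    qed
    then have "?\<beta> (brace dp \<xi> \<eta>) = ?rhs \<xi> \<eta> \<longleftrightarrow> (\<forall>x y. - P_sum x y (\<lambda>u v. \<xi> u * \<eta> v) = 0)"
      unfolding dual_tensor_eq_iff[OF dual_coproduct(1)[OF brace_in] rhs] dual_coproduct(2)[OF brace_in]
      by (metis right_minus_eq)
    then show ?thesis by simp
  qed
  then show ?thesis by (simp add: compatible_def)
qed

section \<open>The equivalence for a decomposed \<open>r\<close>\<close>

theorem coboundary_bialgebra_iff:
  "(mock_pre_lie_algebra fscale (dual s) dp \<and> mock_pre_lie_bialgebra s m \<alpha>) \<longleftrightarrow>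
    ((\<forall>x y. P_minus s m (m x y) (r - tflip r) + P_plus s m x (P_minus s m y (r - tflip r)) = 0) \<and>
     (\<forall>x. Q_op s m x (rr_bracket s m r) = 0))"
proof -
  let ?P_sum = "\<forall>x y f. bil f \<longrightarrow> P_sum x y f = 0"
  let ?mock_form = "\<forall>x f. tril f \<longrightarrow> (\<Sum>i<n. \<Sum>j<n. mock_form x f (a i) (b i) (a j) (b j)) = 0"
  let ?Q_form = "\<forall>x f. tril f \<longrightarrow> (\<Sum>i<n. \<Sum>j<n. Q_form x f (a i) (b i) (a j) (b j)) = 0"
  have "mock_pre_lie_bialgebra s m \<alpha> \<longleftrightarrow> mock_pre_lie_algebra fscale (dual s) dp \<and>
      compatible fscale (dual s) dp (dual_coproduct s m)"
    using coboundary_in_tensor_square coboundary_linear mpl coboundary_compatible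
    by (simp add: mock_pre_lie_bialgebra_def)
  then have "(mock_pre_lie_algebra fscale (dual s) dp \<and> mock_pre_lie_bialgebra s m \<alpha>) \<longleftrightarrow> ?mock_form \<and> ?P_sum"
    unfolding dual_mock_pre_lie_iff dual_compatible_iff mock_form_zero_iff P_sum_zero_iff by blast
  also have "\<dots> \<longleftrightarrow> ?P_sum \<and> ?Q_form"
  proof -
    \<comment> \<open>Fixing the third argument of a trilinear form leaves a bilinear one, so
      condition (i) removes the extra sum in \<open>mock_form_eq\<close>, and
      \<open>mock_form\<close> and \<open>Q_form\<close> have equal sums.\<close>
    have "(\<Sum>j<n. P_sum x (a j) (\<lambda>p q. f p q (b j))) = 0" if ?P_sum "tril f" for x f
    proof -
      have "bil (\<lambda>p q. f p q w)" for w
        using \<open>tril f\<close> by (auto simp: bilinear_on_def trilinear_on_def)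
      with \<open>?P_sum\<close> show ?thesis by (intro sum.neutral) blast
    qed
    then show ?thesis by (auto simp: mock_form_eq)
  qed
  also have "\<dots> \<longleftrightarrow>
    ((\<forall>x y. P_minus s m (m x y) (r - tflip r) + P_plus s m x (P_minus s m y (r - tflip r)) = 0) \<and>
     (\<forall>x. Q_op s m x (rr_bracket s m r) = 0))"
    unfolding cond_i_iff cond_ii_iff by blast
  finally show ?thesis .
qed

end

theorem theorem3p15:
  fixes s :: "'k::{alg_closed_field, field_char_0} \<Rightarrow> 'v::ab_group_add \<Rightarrow> 'v"
    and B :: "'v set" and m :: "'v \<Rightarrow> 'v \<Rightarrow> 'v" and r :: "('v, 'k) tensor2"
  assumes "finite_dimensional_vector_space s B"
    and "mock_pre_lie_algebra s UNIV m"
    and "r \<in> tensor_square s UNIV"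
  shows "(mock_pre_lie_algebra fscale (dual s) (dual_product (coboundary s m r)) \<and>
      mock_pre_lie_bialgebra s m (coboundary s m r)) \<longleftrightarrow>
    ((\<forall>x y. P_minus s m (m x y) (r - tflip r) + P_plus s m x (P_minus s m y (r - tflip r)) = 0) \<and>
     (\<forall>x. Q_op s m x (rr_bracket s m r) = 0))"
proof -
  interpret finite_dimensional_vector_space s B by fact
  \<comment> \<open>Any decomposition will do, as the conclusion drawn from the locale mentions only
    \<open>r\<close>.\<close>
  obtain n a b where r: "r = (\<Sum>i<(n::nat). tens2 s UNIV (a i) (b i))"
    using tensor_square_decomposition[OF assms(3) vector_space_axioms subspace_UNIV] by blast
  interpret mock_pre_lie_coboundary s B m r n a b
    by unfold_locales (fact assms(2) r)+
  show ?thesis by (rule coboundary_bialgebra_iff)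
qed

end
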